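(* Let $d\ge 1$ be an integer and let $\chi_1,\dots,\chi_d$ be Dirichlet characters of the same modulus $q\ge 2$. Then the multiple Lucas $L$-function $\mathcal L_U^d(\mathbf s\mid\chi)$ of depth $d$ can be meromorphically continued to all of $\mathbb{C}^d$, with possible poles on the hyperplanes $$s_j+\cdots+s_d=-2(k_j+\cdots+k_d)+(k_j+\cdots+k_d)\frac{\log|Q|}{\log\alpha}+\left(\frac{2n}{q}+\ell_{Q,k_j,\ldots,k_d}\right)\frac{\pi i}{\log\alpha}$$ for $1\le j\le d$, where $n\in\mathbb{Z}$ and $k_j,\dots,k_d$ are non-negative integers.
   Context: Standing assumptions: $P,Q$ are real numbers with $P>0$, $Q\ne 0$, $D:=P^2-4Q$, and $Q<P-1$ if $0<P\le 2$, $Q\le P-1$ if $P>2$. Let $\alpha,\beta$ be the roots of $x^2-Px+Q=0$, with $\alpha=(P+\sqrt D)/2$, $\beta=(P-\sqrt D)/2$, and let $U_n=(\alpha^n-\beta^n)/(\alpha-\beta)$ for $n\ge 0$ (Lucas sequence of the first kind). Complex powers of positive reals are taken with the real logarithm. For Dirichlet characters $\chi_1,\dots,\chi_d$ modulo $q$, the multiple Lucas $L$-function of depth $d$ is $$\mathcal L_U^d(\mathbf s\mid\chi)=\mathcal L_U^d(s_1,\dots,s_d\mid\chi_1,\dots,\chi_d):=\sum_{0<n_1<n_2<\cdots<n_d}\frac{\chi_1(n_1)}{U_{n_1}^{s_1}}\cdots\frac{\chi_d(n_d)}{U_{n_d}^{s_d}},$$ initially defined for $(s_1,\dots,s_d)\in\mathfrak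 D_d:=\{(s_1,\dots,s_d)\in\mathbb C^d:\ \sum_{i=j}^d\mathrm{Re}(s_i)>0,\ 1\le j\le d\}$, where it converges absolutely. $\ell_{Q,k_j,\dots,k_d}:=0$ if $Q>0$ and $\ell_{Q,k_j,\dots,k_d}:=k_j+\cdots+k_d$ if $Q<0$. *)

theory Defs
  imports "HOL-Analysis.Analysis"
begin

text \<open>
  The coordinates of \<open>\<complex>\<^sup>d\<close> are indexed by a finite linearly ordered type \<open>'d\<close> with \<open>CARD('d) = d\<close>,
  whose elements, in increasing order, play the role of \<open>1, \<dots>, d\<close>.  In particular
  \<open>{j..}\<close> stands for \<open>{j, \<dots>, d}\<close>.
\<close>

subsection \<open>Holomorphic and meromorphic functions of several variables\<close>

text \<open>Complex Frechet differentiability: \<open>c\<close> is the complex gradient of \<open>f\<close> at \<open>z\<close>.\<close>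

definition holomorphic_several_on :: "(complex ^ 'd \<Rightarrow> complex) \<Rightarrow> (complex ^ 'd) set \<Rightarrow> bool" where
  "holomorphic_several_on f S \<longleftrightarrow> open S \<and>
     (\<forall>z\<in>S. \<exists>c :: complex ^ 'd. (f has_derivative (\<lambda>h. \<Sum>i\<in>UNIV. c $ i * h $ i)) (at z))"

text \<open>
  A meromorphic function is locally a quotient \<open>g / h\<close> of holomorphic functions with \<open>h\<close> not
  identically zero on a connected neighbourhood.  It is represented by a total function, whose
  values on the zero set of \<open>h\<close> are not constrained.
\<close>

definition meromorphic_several_on :: "(complex ^ 'd \<Rightarrow> complex) \<Rightarrow> (complex ^ 'd) set \<Rightarrow> bool" where
  "meromorphic_several_on f S \<longleftrightarrow> open S \<and>
     (\<forall>p\<in>S. \<exists>V g h. open V \<and> connected V \<and> p \<in> V \<and> V \<subseteq> S \<and>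
        holomorphic_several_on g V \<and> holomorphic_several_on h V \<and>
        (\<exists>z\<in>V. h z \<noteq> 0) \<and> (\<forall>z\<in>V. h z \<noteq> 0 \<longrightarrow> f z = g z / h z))"

subsection \<open>Dirichlet characters\<close>

definition dirichlet_character :: "nat \<Rightarrow> (int \<Rightarrow> complex) \<Rightarrow> bool" where
  "dirichlet_character q chi \<longleftrightarrow>
     (\<forall>a b. chi (a * b) = chi a * chi b) \<and>
     (\<forall>a. chi (a + int q) = chi a) \<and>
     (\<forall>a. chi a \<noteq> 0 \<longleftrightarrow> coprime a (int q))"

subsection \<open>Lucas sequences and multiple Lucas L-functions\<close>

text \<open>
  For \<open>P > 0\<close> with \<open>Q < P - 1\<close> if \<open>P \<le> 2\<close> and \<open>Q \<le> P - 1\<close> if \<open>P > 2\<close>, the discriminant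
  \<open>P\<^sup>2 - 4 Q\<close> is positive, so the real square root is the intended one; moreover \<open>\<alpha> > 1\<close>, and
  \<open>U\<^sub>n > 0\<close> for \<open>n > 0\<close>.
\<close>

definition lucas_alpha :: "real \<Rightarrow> real \<Rightarrow> real" where
  "lucas_alpha P Q = (P + sqrt (P\<^sup>2 - 4 * Q)) / 2"

definition lucas_beta :: "real \<Rightarrow> real \<Rightarrow> real" where
  "lucas_beta P Q = (P - sqrt (P\<^sup>2 - 4 * Q)) / 2"

definition lucas_U :: "real \<Rightarrow> real \<Rightarrow> nat \<Rightarrow> real" where
  "lucas_U P Q n =
     (lucas_alpha P Q ^ n - lucas_beta P Q ^ n) / (lucas_alpha P Q - lucas_beta P Q)"

text \<open>The sum ranges over all \<open>0 < n\<^sub>1 < \<dots> < n\<^sub>d\<close> and is unconditional, that is, absolute.\<close>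

definition multiple_lucas_L ::
  "real \<Rightarrow> real \<Rightarrow> ('d::{finite,linorder} \<Rightarrow> int \<Rightarrow> complex) \<Rightarrow>
   complex ^ ('d::{finite,linorder}) \<Rightarrow> complex" where
  "multiple_lucas_L P Q chi s =
     (\<Sum>\<^sub>\<infinity>n \<in> {n. strict_mono n \<and> (\<forall>i. 0 < n i)}.
        \<Prod>i\<in>UNIV. chi i (int (n i)) / complex_of_real (lucas_U P Q (n i)) powr (s $ i))"

definition lucas_domain :: "(complex ^ 'd::{finite,linorder}) set" where
  "lucas_domain = {s. \<forall>j. 0 < (\<Sum>i\<in>{j..}. Re (s $ i))}"

definition lucas_ell :: "real \<Rightarrow> nat \<Rightarrow> nat" where
  "lucas_ell Q K = (if Q < 0 then K else 0)"

definition lucas_hyperplane ::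
  "real \<Rightarrow> real \<Rightarrow> nat \<Rightarrow> 'd::{finite,linorder} \<Rightarrow> ('d::{finite,linorder} \<Rightarrow> nat) \<Rightarrow> int \<Rightarrow>
   (complex ^ 'd::{finite,linorder}) set" where
  "lucas_hyperplane P Q q j k n =
     {s. (\<Sum>i\<in>{j..}. s $ i) =
           - 2 * of_nat (\<Sum>i\<in>{j..}. k i)
           + of_nat (\<Sum>i\<in>{j..}. k i) * complex_of_real (ln \<bar>Q\<bar> / ln (lucas_alpha P Q))
           + (2 * of_int n / of_nat q + of_nat (lucas_ell Q (\<Sum>i\<in>{j..}. k i)))
             * (complex_of_real pi * \<i> / complex_of_real (ln (lucas_alpha P Q)))}"

end

theory Submission
  imports Defs "HOL-Complex_Analysis.Cauchy_Integral_Formula"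
begin

text \<open>
  Put \<open>\<rho> = \<beta> / \<alpha>\<close>, so \<open>\<bar>\<rho>\<bar> < 1\<close> and \<open>U\<^sub>n = \<alpha>\<^sup>n (1 - \<rho>\<^sup>n) / (\<alpha> - \<beta>)\<close>.  Expand each factor
  \<open>(1 - \<rho>\<^sup>n)\<close> to the power \<open>- s\<^sub>i\<close> binomially, with index \<open>k\<^sub>i\<close>, and write \<open>n\<^sub>i = m\<^sub>1 + \<dots> + m\<^sub>i\<close> with
  all \<open>m\<^sub>j > 0\<close>.  For fixed \<open>k\<close> the sum over \<open>m\<close> is a geometric series with \<open>q\<close>-periodic weights in the
  variables \<open>y\<^sub>j = \<alpha> powr - (s\<^sub>j + \<dots> + s\<^sub>d) * \<rho> ^ (k\<^sub>j + \<dots> + k\<^sub>d)\<close>, that is, a polynomial in \<open>y\<close>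
  divided by the product of the \<open>1 - y\<^sub>j\<^sup>q\<close>.  The resulting series over \<open>k\<close> converges normally away
  from the zeros of these denominators, because every \<open>m\<^sub>j\<close> is at least \<open>1\<close> and hence the numerators
  decay like \<open>\<bar>\<rho>\<bar> ^ (k\<^sub>1 + \<dots> + k\<^sub>d)\<close>; and \<open>y\<^sub>j\<^sup>q = 1\<close> is the equation of the stated hyperplanes.
\<close>

subsection \<open>Holomorphic functions of several variables\<close>

text \<open>The derivative is kept as a linear map that commutes with complex scalars instead of a
  gradient, so that the calculus of \<open>has_derivative\<close> applies directly and only
  homogeneity has to be carried along.\<close>

definition cdiff_at :: "(complex ^ 'd::finite \<Rightarrow> complex) \<Rightarrow> complex ^ 'd \<Rightarrow> bool" where
  "cdiff_at f z \<longleftrightarrow> (\<exists>D. (f has_derivative D) (at z) \<and> (\<forall>a h. D (a *s h) = a * D h))"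

text \<open>Expanding \<open>h\<close> in the axis vectors shows that a complex homogeneous
  derivative \<open>D\<close> is given by the gradient with entries
  \<open>D (axis i 1)\<close>.\<close>

lemma holomorphic_several_on_iff:
  "holomorphic_several_on f S \<longleftrightarrow> open S \<and> (\<forall>z\<in>S. cdiff_at f z)"
proof -
  have "(\<exists>c :: complex ^ 'a. (f has_derivative (\<lambda>h. \<Sum>i\<in>UNIV. c $ i * h $ i)) (at z)) \<longleftrightarrow> cdiff_at f z" for z
  proof
    assume "\<exists>c :: complex ^ 'a. (f has_derivative (\<lambda>h. \<Sum>i\<in>UNIV. c $ i * h $ i)) (at z)"
    then show "cdiff_at f z"
      unfolding cdiff_at_def by (fastforce simp: sum_distrib_left mult_ac)
  next
    assume "cdiff_at f z"
    then obtain D where D: "(f has_derivative D) (at z)" and hom: "\<And>a h. D (a *s h) = a * D h"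
      unfolding cdiff_at_def by auto
    interpret D: bounded_linear D using D by (rule has_derivative_bounded_linear)
    have "D h = (\<Sum>i\<in>UNIV. (\<chi> i. D (axis i 1)) $ i * h $ i)" for h
    proof -
      have "D h = D (\<Sum>i\<in>UNIV. h $ i *s axis i 1)"
        by (simp add: basis_expansion)
      then show ?thesis
        by (simp add: D.sum hom mult.commute)
    qed
    then have "D = (\<lambda>h. \<Sum>i\<in>UNIV. (\<chi> i. D (axis i 1)) $ i * h $ i)" by blast
    with D show "\<exists>c :: complex ^ 'a. (f has_derivative (\<lambda>h. \<Sum>i\<in>UNIV. c $ i * h $ i)) (at z)"
      by metis
  qed
  then show ?thesis unfolding holomorphic_several_on_def by simp
qed

lemma cdiff_at_const [intro, simp]: "cdiff_at (\<lambda>_. c) z"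
  unfolding cdiff_at_def by (rule exI[of _ "\<lambda>_. 0"]) auto

lemma cdiff_at_nth [intro, simp]: "cdiff_at (\<lambda>s. s $ i) z"
  unfolding cdiff_at_def
  by (rule exI[of _ "\<lambda>h. h $ i"]) (auto intro!: bounded_linear_imp_has_derivative bounded_linear_vec_nth)

lemma cdiff_at_add [intro]: "cdiff_at f z \<Longrightarrow> cdiff_at g z \<Longrightarrow> cdiff_at (\<lambda>s. f s + g s) z"
  unfolding cdiff_at_def
  by (elim exE conjE, rule exI, rule conjI, erule (1) has_derivative_add) (simp add: algebra_simps)

lemma cdiff_at_mult [intro]: "cdiff_at f z \<Longrightarrow> cdiff_at g z \<Longrightarrow> cdiff_at (\<lambda>s. f s * g s) z"
  unfolding cdiff_at_def
  by (elim exE conjE, rule exI, rule conjI, erule (1) has_derivative_mult) (simp add: algebra_simps)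

lemma cdiff_at_compose:
  assumes "cdiff_at f z" "g field_differentiable at (f z)"
  shows "cdiff_at (\<lambda>s. g (f s)) z"
proof -
  obtain D where D: "(f has_derivative D) (at z)" and hom: "\<And>a h. D (a *s h) = a * D h"
    using assms(1) unfolding cdiff_at_def by auto
  obtain g' where "(g has_field_derivative g') (at (f z))"
    using assms(2) unfolding field_differentiable_def by auto
  then have "(g has_derivative (\<lambda>h. g' * h)) (at (f z))"
    by (simp add: has_field_derivative_def)
  then have "((\<lambda>s. g (f s)) has_derivative (\<lambda>h. g' * D h)) (at z)"
    using has_derivative_compose[OF D] by auto
  then show ?thesis unfolding cdiff_at_def using hom by (auto simp: algebra_simps)
qed

lemma cdiff_at_exp [intro]: "cdiff_at f z \<Longrightarrow> cdiff_at (\<lambda>s. exp (f s)) z"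
  by (rule cdiff_at_compose) (auto intro: field_differentiable_within_exp)

lemma cdiff_at_inverse [intro]: "cdiff_at f z \<Longrightarrow> f z \<noteq> 0 \<Longrightarrow> cdiff_at (\<lambda>s. inverse (f s)) z"
  by (rule cdiff_at_compose[where g = inverse]) (auto intro: derivative_intros field_differentiable_inverse)

lemma cdiff_at_diff [intro]:
  assumes "cdiff_at f z" "cdiff_at g z" shows "cdiff_at (\<lambda>s. f s - g s) z"
proof -
  have "cdiff_at (\<lambda>s. f s + (-1) * g s) z" using assms by (intro cdiff_at_add cdiff_at_mult) auto
  then show ?thesis by simp
qed

lemma cdiff_at_divide [intro]:
  "cdiff_at f z \<Longrightarrow> cdiff_at g z \<Longrightarrow> g z \<noteq> 0 \<Longrightarrow> cdiff_at (\<lambda>s. f s / g s) z"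
  unfolding divide_inverse by auto

lemma cdiff_at_prod [intro]:
  "(\<And>i. i \<in> I \<Longrightarrow> cdiff_at (f i) z) \<Longrightarrow> cdiff_at (\<lambda>s. \<Prod>i\<in>I. f i s) z"
  by (induction I rule: infinite_finite_induct) auto

lemma cdiff_at_sum [intro]:
  "(\<And>i. i \<in> I \<Longrightarrow> cdiff_at (f i) z) \<Longrightarrow> cdiff_at (\<lambda>s. \<Sum>i\<in>I. f i s) z"
  by (induction I rule: infinite_finite_induct) auto

lemma cdiff_at_power [intro]: "cdiff_at f z \<Longrightarrow> cdiff_at (\<lambda>s. f s ^ n) z"
  by (induction n) auto

lemma cdiff_at_transform:
  assumes "cdiff_at f z" "open V" "z \<in> V" "\<And>s. s \<in> V \<Longrightarrow> f s = g s"
  shows "cdiff_at g z"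
  using assms has_derivative_transform_within_open unfolding cdiff_at_def by blast

section \<open>Cauchy estimates and termwise differentiation of series\<close>

lemma norm_vector_smult: "norm (a *s h) = norm a * norm (h :: complex ^ 'd::finite)"
  unfolding norm_vec_def by (simp add: norm_mult L2_set_right_distrib)

text \<open>Cauchy's inequality on the complex line through \<open>x\<close> in the direction \<open>h\<close>.\<close>

lemma cdiff_at_Cauchy_bound:
  fixes f :: "complex ^ 'd::finite \<Rightarrow> complex"
  assumes r: "r > 0" and diff: "\<And>y. y \<in> ball x r \<Longrightarrow> cdiff_at f y"
    and bound: "\<And>y. y \<in> ball x r \<Longrightarrow> norm (f y) \<le> M"
    and D: "(f has_derivative D) (at x)" and hom: "\<And>a h. D (a *s h) = a * D h"
  shows "norm (D h) \<le> 2 * M / r * norm h"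
proof (cases "h = 0")
  case True
  then show ?thesis using hom[of 0 h] by simp
next
  case False
  \<comment> \<open>With this radius \<open>t *s h\<close> has norm at most \<open>r / 2\<close> on
    the closed disc, which therefore stays inside the ball; the factor 2 of the bound comes from
    here.\<close>
  define \<rho> where "\<rho> = r / (2 * norm h)"
  have \<rho>: "\<rho> > 0" using r False by (simp add: \<rho>_def)
  define \<phi> where "\<phi> = (\<lambda>t::complex. f (x + t *s h))"
  have line: "((\<lambda>t. x + t *s h) has_derivative (\<lambda>t. t *s h)) (at t)" for t :: complex
  proof -
    have "linear (\<lambda>t::complex. t *s h)"
      by (rule linearI) (simp_all add: vec_eq_iff algebra_simps)
    then have "bounded_linear (\<lambda>t::complex. t *s h)" by (rule linear_conv_bounded_linear[THEN iffD1])
    then show ?thesis by (auto intro!: derivative_eq_intros bounded_linear_imp_has_derivative)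
  qed
  have in_ball: "x + t *s h \<in> ball x r" if "norm t \<le> \<rho>" for t
  proof -
    have "norm t * norm h \<le> \<rho> * norm h" using that by (intro mult_right_mono) auto
    also have "\<dots> < r" using r False by (simp add: \<rho>_def)
    finally show ?thesis by (simp add: dist_norm norm_vector_smult)
  qed
  have deriv: "(\<phi> has_field_derivative E h) (at t)"
    if "(f has_derivative E) (at (x + t *s h))" "\<And>a h. E (a *s h) = a * E h" for t E
  proof -
    have "(\<phi> has_derivative (\<lambda>u. E (u *s h))) (at t)"
      unfolding \<phi>_def using has_derivative_compose[OF line that(1)] by simp
    moreover have "(\<lambda>u. E (u *s h)) = (*) (E h)" using that(2) by (auto simp: mult.commute)
    ultimately show ?thesis by (simp add: has_field_derivative_def)
  qed
  have fd: "\<phi> field_differentiable at t" if "norm t \<le> \<rho>" for t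
    using diff[OF in_ball[OF that]] deriv unfolding cdiff_at_def field_differentiable_def by blast
  have "norm ((deriv ^^ 1) \<phi> 0) \<le> fact 1 * M / \<rho> ^ 1"
  proof (rule Cauchy_inequality)
    show "\<phi> holomorphic_on ball 0 \<rho>"
      using fd by (auto simp: holomorphic_on_def intro: field_differentiable_at_within)
    show "continuous_on (cball 0 \<rho>) \<phi>"
      using fd by (auto intro!: continuous_at_imp_continuous_on field_differentiable_imp_continuous_at)
    show "norm (\<phi> t) \<le> M" if "norm (0 - t) = \<rho>" for t
      using bound[OF in_ball[of t]] that by (simp add: \<phi>_def)
  qed (use \<rho> in auto)
  moreover have "deriv \<phi> 0 = D h"
    using deriv[of D 0] D hom by (intro DERIV_imp_deriv) auto
  ultimately show ?thesis using False r by (simp add: \<rho>_def mult_ac)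
qed

text \<open>The Weierstrass theorem: Cauchy's inequality turns the majorant \<open>M\<close> of the
  terms into one of their derivatives, uniformly in the point, so the series may be differentiated
  term by term. Homogeneity passes to the sum of the derivatives.\<close>

lemma cdiff_at_suminf:
  fixes f :: "nat \<Rightarrow> complex ^ 'd::finite \<Rightarrow> complex"
  assumes "open S" "z \<in> S"
    and diff: "\<And>n x. x \<in> S \<Longrightarrow> cdiff_at (f n) x"
    and bound: "\<And>n x. x \<in> S \<Longrightarrow> norm (f n x) \<le> M n"
    and M: "summable M"
  shows "cdiff_at (\<lambda>x. \<Sum>n. f n x) z"
proof -
  obtain r0 where "r0 > 0" and r0: "ball z r0 \<subseteq> S"
    using assms(1,2) open_contains_ball by blast
  \<comment> \<open>Half the radius is kept in reserve: every point of \<open>B\<close> has a ball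
    of the same radius \<open>r\<close> inside \<open>S\<close>, so the Cauchy bounds are uniform on
    \<open>B\<close>.\<close>
  define r where "r = r0 / 2"
  have r: "r > 0" using \<open>r0 > 0\<close> by (simp add: r_def)
  define B where "B = ball z r"
  have BS: "ball x r \<subseteq> S" if "x \<in> B" for x
  proof -
    have "ball x r \<subseteq> ball z r0"
    proof
      fix y assume "y \<in> ball x r"
      then show "y \<in> ball z r0"
        using that dist_triangle[of z y x] by (simp add: B_def r_def)
    qed
    then show ?thesis using r0 by blast
  qed
  have BS': "x \<in> S" if "x \<in> B" for x
    using BS[OF that] r by auto
  have "\<forall>n x. \<exists>D. x \<in> B \<longrightarrow> (f n has_derivative D) (at x) \<and> (\<forall>a h. D (a *s h) = a * D h)"
    using diff BS' unfolding cdiff_at_def by blast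
  then obtain D where D: "\<And>n x. x \<in> B \<Longrightarrow> (f n has_derivative D n x) (at x)"
    and hom: "\<And>n x a h. x \<in> B \<Longrightarrow> D n x (a *s h) = a * D n x h"
    by metis
  have Dbound: "norm (D n x h) \<le> (2 / r * norm h) * M n" if "x \<in> B" for n x h
  proof -
    have "norm (D n x h) \<le> 2 * M n / r * norm h"
      by (rule cdiff_at_Cauchy_bound[OF r _ _ D[OF that] hom[OF that]]) (use BS[OF that] diff bound in auto)
    then show ?thesis by (simp add: mult_ac)
  qed
  have Dsum: "summable (\<lambda>n. D n x h)" if "x \<in> B" for x h
    by (rule summable_comparison_test'[OF summable_mult[OF M, of "2 / r * norm h"]]) (rule Dbound[OF that])
  define E where "E = (\<lambda>x h. \<Sum>n. D n x h)"
  have Msum: "\<And>n. (\<lambda>k. M (k + n)) sums (suminf M - (\<Sum>i<n. M i))"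
    by (simp add: sums_iff_shift summable_sums M)
  \<comment> \<open>The error is linear in \<open>norm h\<close> with a factor independent of
    \<open>x\<close>, which is the uniformity that \<open>has_derivative_series\<close> asks
    for.\<close>
  have tail: "norm ((\<Sum>i<n. D i x h) - E x h) \<le> (2 / r * (suminf M - (\<Sum>i<n. M i))) * norm h"
    if "x \<in> B" for n x h
  proof -
    have "(\<lambda>k. D (k + n) x h) sums (E x h - (\<Sum>i<n. D i x h))"
      unfolding sums_iff_shift[of "\<lambda>k. D k x h"] using summable_sums[OF Dsum[OF that]]
      by (simp add: E_def)
    then have "norm (E x h - (\<Sum>i<n. D i x h)) = norm (\<Sum>k. D (k + n) x h)"
      by (simp add: sums_iff)
    also have "\<dots> \<le> (\<Sum>k. (2 / r * norm h) * M (k + n))"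
    proof (rule norm_suminf_le)
      show "norm (D (k + n) x h) \<le> (2 / r * norm h) * M (k + n)" for k by (rule Dbound[OF that])
      show "summable (\<lambda>k. (2 / r * norm h) * M (k + n))"
        by (rule summable_mult) (rule sums_summable[OF Msum])
    qed
    also have "\<dots> = (2 / r * norm h) * (suminf M - (\<Sum>i<n. M i))"
      using sums_unique[OF sums_mult[OF Msum[of n], of "2 / r * norm h"]] by simp
    finally show ?thesis by (simp add: norm_minus_commute mult_ac)
  qed
  have tl0: "(\<lambda>n. 2 / r * (suminf M - (\<Sum>i<n. M i))) \<longlonglongrightarrow> 2 / r * (suminf M - suminf M)"
    by (intro tendsto_intros summable_LIMSEQ M)
  have fs: "(\<lambda>n. f n x) sums (\<Sum>n. f n x)" if "x \<in> B" for x
    by (intro summable_sums summable_comparison_test'[OF M, of 0] bound BS' that)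
  have zB: "z \<in> B" using r by (simp add: B_def)
  have "\<exists>g. \<forall>x\<in>B. (\<lambda>n. f n x) sums (g x) \<and> (g has_derivative E x) (at x within B)"
  proof (rule has_derivative_series)
    show "convex B" by (simp add: B_def)
    show "(f n has_derivative D n x) (at x within B)" if "x \<in> B" for n x
      using D[OF that] has_derivative_at_withinI by blast
    show "\<forall>\<^sub>F n in sequentially. \<forall>x\<in>B. \<forall>h. norm ((\<Sum>i<n. D i x h) - E x h) \<le> e * norm h"
      if "e > 0" for e
    proof -
      have "\<forall>\<^sub>F n in sequentially. 2 / r * (suminf M - (\<Sum>i<n. M i)) < e"
        using order_tendstoD(2)[OF tl0, of e] that by simp
      then show ?thesis
      proof eventually_elim
        case (elim n)
        show ?case
        proof (intro ballI allI)
          fix x h assume "x \<in> B"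
          show "norm ((\<Sum>i<n. D i x h) - E x h) \<le> e * norm h"
            by (rule order.trans[OF tail[OF \<open>x \<in> B\<close>]], rule mult_right_mono) (use elim in auto)
        qed
      qed
    qed
  qed (use zB fs in auto)
  then obtain g where g: "\<And>x. x \<in> B \<Longrightarrow> (\<lambda>n. f n x) sums (g x)"
    and gD: "\<And>x. x \<in> B \<Longrightarrow> (g has_derivative E x) (at x within B)" by blast
  have "open B" by (simp add: B_def)
  have "(g has_derivative E z) (at z)"
    using gD[OF zB] at_within_open[OF zB \<open>open B\<close>] by simp
  moreover have "E z (a *s h) = a * E z h" for a h
    unfolding E_def using hom[OF zB] Dsum[OF zB] by (simp add: suminf_mult)
  ultimately have "cdiff_at g z" unfolding cdiff_at_def by blast
  then show ?thesis
    by (rule cdiff_at_transform[OF _ \<open>open B\<close> zB]) (simp add: sums_unique[OF g, symmetric])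
qed

text \<open>The continued series runs over multi-indices; as the convergence is absolute, any
  enumeration of them reduces it to a series over the naturals.\<close>

lemma cdiff_at_infsum:
  fixes f :: "'k::countable \<Rightarrow> complex ^ 'd::finite \<Rightarrow> complex"
  assumes inf: "infinite (UNIV :: 'k set)"
    and "open S" "z \<in> S"
    and diff: "\<And>k x. x \<in> S \<Longrightarrow> cdiff_at (f k) x"
    and bound: "\<And>k x. x \<in> S \<Longrightarrow> norm (f k x) \<le> M k"
    and M: "M summable_on UNIV"
  shows "cdiff_at (\<lambda>x. \<Sum>\<^sub>\<infinity>k. f k x) z"
proof -
  define e :: "nat \<Rightarrow> 'k" where "e = from_nat_into UNIV"
  have e: "bij_betw e UNIV UNIV"
    unfolding e_def by (rule bij_betw_from_nat_into) (use inf in auto)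
  have M': "(\<lambda>n. M (e n)) summable_on UNIV"
    using M summable_on_reindex_bij_betw[OF e, of M] by simp
  have "cdiff_at (\<lambda>x. \<Sum>n. f (e n) x) z"
  proof (rule cdiff_at_suminf[OF assms(2,3)])
    show "summable (\<lambda>n. M (e n))" using has_sum_imp_sums[OF has_sum_infsum[OF M']] by (rule sums_summable)
  qed (use diff bound in auto)
  then show ?thesis
  proof (rule cdiff_at_transform[OF _ assms(2,3)])
    fix s assume s: "s \<in> S"
    have "(\<lambda>n. norm (f (e n) s)) summable_on UNIV"
      by (rule Infinite_Sum.abs_summable_on_comparison_test'[OF M']) (use bound[OF s] in auto)
    then have "(\<lambda>n. f (e n) s) summable_on UNIV" by (rule abs_summable_summable)
    then have "(\<lambda>n. f (e n) s) sums (\<Sum>\<^sub>\<infinity>n. f (e n) s)"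
      by (intro has_sum_imp_sums has_sum_infsum)
    then show "(\<Sum>n. f (e n) s) = (\<Sum>\<^sub>\<infinity>k. f k s)"
      using infsum_reindex_bij_betw[OF e, of "\<lambda>k. f k s"] by (simp add: sums_iff)
  qed
qed

subsection \<open>Multiple power series\<close>

text \<open>A finite set of multi-indices lies in the box spanned by its coordinate projections.
  Over a box the sum factors, which bounds it by the product of the full one-variable sums.\<close>

lemma summable_on_prod_fun:
  fixes f :: "'d::finite \<Rightarrow> 'b \<Rightarrow> real"
  assumes nonneg: "\<And>i x. f i x \<ge> 0" and summable: "\<And>i. f i summable_on UNIV"
  shows "(\<lambda>k. \<Prod>i\<in>UNIV. f i (k i)) summable_on UNIV"
proof (rule nonneg_bdd_above_summable_on)
  show "bdd_above (sum (\<lambda>k. \<Prod>i\<in>UNIV. f i (k i)) ` {F. F \<subseteq> UNIV \<and> finite F})"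
  proof (rule bdd_aboveI2)
    fix F :: "('d \<Rightarrow> 'b) set"
    assume "F \<in> {F. F \<subseteq> UNIV \<and> finite F}"
    then have fin: "finite F" by simp
    let ?B = "\<lambda>i. (\<lambda>k. k i) ` F"
    have "(\<Sum>k\<in>F. \<Prod>i\<in>UNIV. f i (k i)) \<le> (\<Sum>k\<in>PiE UNIV ?B. \<Prod>i\<in>UNIV. f i (k i))"
      using fin by (intro sum_mono2 prod_nonneg finite_PiE ballI nonneg) auto
    also have "\<dots> = (\<Prod>i\<in>UNIV. \<Sum>x\<in>?B i. f i x)"
      using fin by (subst prod_sum_PiE) auto
    also have "\<dots> \<le> (\<Prod>i\<in>UNIV. infsum (f i) UNIV)"
      using fin by (intro prod_mono conjI sum_nonneg nonneg finite_sum_le_infsum summable) auto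
    finally show "(\<Sum>k\<in>F. \<Prod>i\<in>UNIV. f i (k i)) \<le> (\<Prod>i\<in>UNIV. infsum (f i) UNIV)" .
  qed
qed (auto intro: prod_nonneg nonneg)

lemma infsum_prod_fun:
  fixes f :: "'d::finite \<Rightarrow> 'b \<Rightarrow> complex"
  assumes "\<And>i. (\<lambda>x. norm (f i x)) summable_on UNIV"
  shows "(\<Sum>\<^sub>\<infinity>k. \<Prod>i\<in>UNIV. f i (k i)) = (\<Prod>i\<in>UNIV. infsum (f i) UNIV)"
  using infsum_prod_PiE_abs[of UNIV f "\<lambda>_. UNIV"] assms by (simp add: PiE_UNIV_domain)

section \<open>The binomial series with Pochhammer symbols\<close>

lemma norm_pochhammer_le:
  fixes s :: complex
  assumes "norm s \<le> R"
  shows "norm (pochhammer s n) \<le> pochhammer R n"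
  unfolding pochhammer_prod prod_norm[symmetric]
proof (rule prod_mono)
  fix i
  have "norm (s + of_nat i) \<le> norm s + norm (of_nat i :: complex)" by (rule norm_triangle_ineq)
  then show "0 \<le> norm (s + of_nat i) \<and> norm (s + of_nat i) \<le> R + of_nat i" using assms by simp
qed

lemma pochhammer_real_nonneg: "R \<ge> 0 \<Longrightarrow> pochhammer (R::real) n \<ge> 0"
  unfolding pochhammer_prod by (intro prod_nonneg) auto

text \<open>The signs of \<open>(- s) gchoose n\<close> and \<open>(- z) ^ n\<close> cancel. In this
  form replacing \<open>s\<close> by a real \<open>R\<close> with \<open>norm s \<le> R\<close> and
  \<open>z\<close> by its norm gives a majorant with nonnegative terms.\<close>

lemma sums_pochhammer_complex:
  fixes s z :: complex
  assumes "norm z < 1"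
  shows "(\<lambda>n. pochhammer s n / fact n * z ^ n) sums (1 - z) powr (- s)"
proof -
  have "((- s) gchoose n) * (- z) ^ n = pochhammer s n / fact n * z ^ n" for n
  proof -
    have "((- s) gchoose n) * (- z) ^ n = pochhammer s n / fact n * ((- 1) ^ n * (- z) ^ n)"
      by (simp add: gbinomial_pochhammer)
    also have "(- 1) ^ n * (- z) ^ n = z ^ n" by (simp flip: power_mult_distrib)
    finally show ?thesis .
  qed
  then show ?thesis using gen_binomial_complex[of "- z" "- s"] assms by simp
qed

lemma summable_on_pochhammer_real:
  fixes R x :: real
  assumes "R \<ge> 0" "0 \<le> x" "x < 1"
  shows "(\<lambda>n. pochhammer R n / fact n * x ^ n) summable_on UNIV"
proof (rule norm_summable_imp_summable_on)
  have "(\<lambda>n. pochhammer (of_real R) n / fact n * of_real x ^ n :: complex) sums (1 - of_real x) powr (- of_real R)"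
    using assms by (intro sums_pochhammer_complex) auto
  then have "summable (\<lambda>n. complex_of_real (pochhammer R n / fact n * x ^ n))"
    by (simp add: sums_iff pochhammer_of_real)
  then have "summable (\<lambda>n. pochhammer R n / fact n * x ^ n)"
    by (simp only: summable_complex_of_real)
  moreover have "norm (pochhammer R n / fact n * x ^ n) = pochhammer R n / fact n * x ^ n" for n
    using assms pochhammer_real_nonneg[of R n] by simp
  ultimately show "summable (\<lambda>n. norm (pochhammer R n / fact n * x ^ n))"
    by simp
qed

subsection \<open>The continued series\<close>

text \<open>In the application \<open>L\<close> is the logarithm of \<alpha>, \<open>\<rho>\<close>
  is \<beta> / \<alpha>, and \<open>w\<close> is the product of the character values as a function
  of the gaps between successive indices. Of the characters only the periodicity in these gaps
  enters.\<close>

locale lucas_continuation =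
  fixes L \<rho> :: real and q :: nat and w :: "('d::{finite,linorder} \<Rightarrow> nat) \<Rightarrow> complex"
  assumes L: "L > 0" and \<rho>: "\<bar>\<rho>\<bar> < 1" and q: "q > 0"
    and periodic: "\<And>r t. w (\<lambda>j. r j + q * t j) = w r"
begin

text \<open>The exponent \<open>K\<close> is a separate argument because \<open>k\<close> enters
  only through its tail sums. The possible poles are thus indexed by pairs \<open>(j, K)\<close>,
  and only small \<open>K\<close> matter near a given point.\<close>

definition y :: "complex ^ ('d::{finite,linorder}) \<Rightarrow> 'd \<Rightarrow> nat \<Rightarrow> complex" where
  "y s j K = exp (- of_real L * (\<Sum>i\<in>{j..}. s $ i)) * of_real \<rho> ^ K"

definition coef :: "complex ^ ('d::{finite,linorder}) \<Rightarrow> ('d \<Rightarrow> nat) \<Rightarrow> complex" where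
  "coef s k = (\<Prod>i\<in>UNIV. pochhammer (s $ i) (k i) / fact (k i))"

definition tail :: "('d \<Rightarrow> nat) \<Rightarrow> 'd \<Rightarrow> nat" where
  "tail k j = (\<Sum>i\<in>{j..}. k i)"

text \<open>The numerator left after summing the geometric series over each residue class. The
  exponent is \<open>Suc (r j)\<close> because gaps are at least 1 while \<open>r j\<close> starts
  at 0; the extra factor \<open>x j\<close> is what makes the series over \<open>k\<close>
  converge.\<close>

definition num :: "('d \<Rightarrow> complex) \<Rightarrow> complex" where
  "num x = (\<Sum>r\<in>UNIV \<rightarrow>\<^sub>E {..<q}. w r * (\<Prod>j\<in>UNIV. x j ^ Suc (r j)))"

text \<open>At a pole the undefined quotients take the value 0, which is harmless since a
  meromorphic function is unconstrained there.\<close>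

definition F :: "complex ^ ('d::{finite,linorder}) \<Rightarrow> complex" where
  "F s = (\<Sum>\<^sub>\<infinity>k. coef s k * num (\<lambda>j. y s j (tail k j)) / (\<Prod>j\<in>UNIV. 1 - y s j (tail k j) ^ q))"

lemma finite_box: "finite (UNIV \<rightarrow>\<^sub>E {..<q} :: ('d \<Rightarrow> nat) set)"
  by (intro finite_PiE) auto

lemma le_tail: "k j \<le> tail k j"
  unfolding tail_def by (rule member_le_sum) auto

text \<open>Of each tail sum only its first entry is kept, so that the majorant factors over the
  coordinates of \<open>k\<close>.\<close>

lemma prod_tail_le: "(\<Prod>j\<in>UNIV. \<bar>\<rho>\<bar> ^ tail k j) \<le> (\<Prod>j\<in>UNIV. \<bar>\<rho>\<bar> ^ k j)"
  using \<rho> by (intro prod_mono conjI power_decreasing le_tail) auto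

lemma norm_coef_le:
  assumes "\<And>i. norm (s $ i) \<le> R"
  shows "norm (coef s k) \<le> (\<Prod>i\<in>UNIV. pochhammer R (k i) / fact (k i))"
  unfolding coef_def prod_norm[symmetric]
  by (intro prod_mono) (auto simp: norm_divide intro!: divide_right_mono norm_pochhammer_le assms)

text \<open>Every exponent \<open>Suc (r j)\<close> lies between 1 and \<open>q\<close>: the lower
  bound saves one factor \<open>\<bar>\<rho>\<bar> ^ K j\<close>, the upper one limits the power of
  \<open>E\<close>.\<close>

lemma norm_num_le:
  assumes E: "E \<ge> 1" and x: "\<And>j. norm (x j) \<le> E * \<bar>\<rho>\<bar> ^ K j"
  shows "norm (num x) \<le> (\<Sum>r\<in>UNIV \<rightarrow>\<^sub>E {..<q}. norm (w r)) * (E ^ q) ^ CARD('d) * (\<Prod>j\<in>UNIV. \<bar>\<rho>\<bar> ^ K j)"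
proof -
  have "norm (w r * (\<Prod>j\<in>UNIV. x j ^ Suc (r j))) \<le> norm (w r) * ((E ^ q) ^ CARD('d) * (\<Prod>j\<in>UNIV. \<bar>\<rho>\<bar> ^ K j))"
    if r: "r \<in> UNIV \<rightarrow>\<^sub>E {..<q}" for r
  proof -
    have "norm (x j) ^ Suc (r j) \<le> E ^ q * \<bar>\<rho>\<bar> ^ K j" for j
    proof -
      have "norm (x j) ^ Suc (r j) \<le> (E * \<bar>\<rho>\<bar> ^ K j) ^ Suc (r j)" by (intro power_mono x) auto
      also have "\<dots> = E ^ Suc (r j) * (\<bar>\<rho>\<bar> ^ K j) ^ Suc (r j)" by (simp only: power_mult_distrib)
      also have "\<dots> \<le> E ^ q * (\<bar>\<rho>\<bar> ^ K j) ^ 1"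
      proof (rule mult_mono)
        have "Suc (r j) \<le> q" using r by (auto simp: PiE_iff Suc_le_eq)
        then show "E ^ Suc (r j) \<le> E ^ q" using E by (rule power_increasing)
        show "(\<bar>\<rho>\<bar> ^ K j) ^ Suc (r j) \<le> (\<bar>\<rho>\<bar> ^ K j) ^ 1"
          using \<rho> by (intro power_decreasing) (auto intro: power_le_one)
      qed (use E in auto)
      finally show ?thesis by simp
    qed
    then have "(\<Prod>j\<in>UNIV. norm (x j) ^ Suc (r j)) \<le> (\<Prod>j\<in>UNIV. E ^ q * \<bar>\<rho>\<bar> ^ K j)"
      by (intro prod_mono) auto
    also have "\<dots> = (E ^ q) ^ CARD('d) * (\<Prod>j\<in>UNIV. \<bar>\<rho>\<bar> ^ K j)" by (simp add: prod.distrib)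
    finally show ?thesis
      by (simp only: norm_mult prod_norm[symmetric] norm_power mult_left_mono norm_ge_zero)
  qed
  then have "norm (num x) \<le> (\<Sum>r\<in>UNIV \<rightarrow>\<^sub>E {..<q}. norm (w r) * ((E ^ q) ^ CARD('d) * (\<Prod>j\<in>UNIV. \<bar>\<rho>\<bar> ^ K j)))"
    unfolding num_def by (rule sum_norm_le)
  then show ?thesis by (simp only: sum_distrib_right mult.assoc)
qed

lemma cdiff_at_y [intro]: "cdiff_at (\<lambda>s. y s j K) z"
  unfolding y_def by (intro cdiff_at_mult cdiff_at_exp cdiff_at_const cdiff_at_sum cdiff_at_nth cdiff_at_power)

lemma cdiff_at_coef [intro]: "cdiff_at (\<lambda>s. coef s k) z"
  unfolding coef_def pochhammer_prod
  by (intro cdiff_at_prod cdiff_at_divide cdiff_at_add cdiff_at_nth cdiff_at_const) auto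

lemma cdiff_at_num [intro]: "cdiff_at (\<lambda>s. num (\<lambda>j. y s j (K j))) z"
  unfolding num_def by (intro cdiff_at_sum cdiff_at_mult cdiff_at_const cdiff_at_prod cdiff_at_power cdiff_at_y)

lemma norm_y: "norm (y s j K) = exp (- L * (\<Sum>i\<in>{j..}. Re (s $ i))) * \<bar>\<rho>\<bar> ^ K"
  by (simp add: y_def norm_mult norm_power)

lemma summable_on_coef_bound:
  assumes "R \<ge> 0"
  shows "(\<lambda>k. \<Prod>i\<in>(UNIV::'d set). pochhammer R (k i) / fact (k i) * \<bar>\<rho>\<bar> ^ k i) summable_on UNIV"
  using assms \<rho> pochhammer_real_nonneg[OF assms]
  by (intro summable_on_prod_fun summable_on_pochhammer_real) auto

lemma infinite_UNIV_index: "infinite (UNIV :: ('d \<Rightarrow> nat) set)"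
proof
  assume "finite (UNIV :: ('d \<Rightarrow> nat) set)"
  then have "finite ((\<lambda>f. f undefined) ` (UNIV :: ('d \<Rightarrow> nat) set))" by (rule finite_imageI)
  moreover have "(\<lambda>f. f undefined) ` (UNIV :: ('d \<Rightarrow> nat) set) = UNIV"
    by (auto intro!: image_eqI[where x = "\<lambda>_. _"])
  ultimately show False by simp
qed

section \<open>Clearing denominators near a point\<close>

text \<open>Moving the last coordinate by a real \<open>t\<close> changes the real part of every
  tail sum by \<open>t\<close>, since the last index belongs to each \<open>{j..}\<close>. A pole
  forces \<open>norm (y z j K) = 1\<close>, which fixes \<open>t\<close> for each of the finitely
  many pairs \<open>(j, K)\<close>.\<close>

lemma exists_nonpole_near:
  "\<exists>z\<in>ball p 1. \<forall>j. \<forall>K<N. y z j K ^ q \<noteq> 1"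
proof -
  define bad where "bad = (\<lambda>(j, K). ln (\<bar>\<rho>\<bar> ^ K) / L - (\<Sum>i\<in>{j..}. Re (p $ i))) ` ((UNIV :: 'd set) \<times> {..<N})"
  have "finite bad" unfolding bad_def by auto
  then have "infinite ({0<..<1} - bad)" by (simp add: infinite_Ioo)
  then have "{0<..<1} - bad \<noteq> {}" by (rule infinite_imp_nonempty)
  then obtain t where "t \<in> {0<..<1} - bad" by blast
  then have t: "0 < t" "t < 1" "t \<notin> bad" by simp_all
  define z where "z = p + axis (Max UNIV) (of_real t)"
  have Re_z: "(\<Sum>i\<in>{j..}. Re (z $ i)) = (\<Sum>i\<in>{j..}. Re (p $ i)) + t" for j
  proof -
    have "(\<Sum>i\<in>{j..}. Re (z $ i)) = (\<Sum>i\<in>{j..}. Re (p $ i)) + (\<Sum>i\<in>{j..}. if Max UNIV = i then t else 0)"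
      unfolding sum.distrib[symmetric] by (intro sum.cong) (auto simp: z_def axis_def)
    then show ?thesis by simp
  qed
  have "y z j K ^ q \<noteq> 1" if "K < N" for j K
  proof
    assume "y z j K ^ q = 1"
    then have "norm (y z j K) ^ q = 1" by (simp flip: norm_power)
    then have "norm (y z j K) = 1"
      using q power_eq_iff_eq_base[of q "norm (y z j K)" 1] by simp
    then have eq: "exp (- L * ((\<Sum>i\<in>{j..}. Re (p $ i)) + t)) * \<bar>\<rho>\<bar> ^ K = 1"
      by (simp add: norm_y Re_z)
    have "\<bar>\<rho>\<bar> ^ K \<noteq> 0"
    proof
      assume "\<bar>\<rho>\<bar> ^ K = 0"
      with eq show False by (simp only: mult_zero_right zero_neq_one)
    qed
    moreover have "0 \<le> \<bar>\<rho>\<bar> ^ K" by simp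
    ultimately have "0 < \<bar>\<rho>\<bar> ^ K" by linarith
    then have "- L * ((\<Sum>i\<in>{j..}. Re (p $ i)) + t) + ln (\<bar>\<rho>\<bar> ^ K) = 0"
      using arg_cong[OF eq, of ln] by (simp only: ln_mult_pos exp_gt_zero ln_exp ln_one)
    then have "t = ln (\<bar>\<rho>\<bar> ^ K) / L - (\<Sum>i\<in>{j..}. Re (p $ i))"
      using L by (simp add: field_simps)
    then have "t \<in> bad" unfolding bad_def using that by force
    with t show False by simp
  qed
  moreover have "z \<in> ball p 1"
  proof -
    have "z - p = of_real t *s axis (Max UNIV) 1" by (simp add: z_def vec_eq_iff axis_def)
    moreover have "norm (axis (Max UNIV) 1 :: complex ^ ('d::{finite,linorder})) = 1"
      by (simp add: norm_eq_sqrt_inner inner_axis_axis)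
    ultimately have "norm (z - p) = t" using t by (simp add: norm_vector_smult)
    then show ?thesis using t by (simp add: dist_norm norm_minus_commute)
  qed
  ultimately show ?thesis by blast
qed

text \<open>
  Near any point only finitely many of the denominators can vanish.  Multiplying the series by
  their product \<open>h\<close> leaves a normally convergent series of holomorphic functions.
\<close>

lemma F_local_quotient:
  obtains g h where "\<And>z. z \<in> ball p 1 \<Longrightarrow> cdiff_at g z" "\<And>z. z \<in> ball p 1 \<Longrightarrow> cdiff_at h z"
    "\<exists>z\<in>ball p 1. h z \<noteq> 0" "\<And>z. z \<in> ball p 1 \<Longrightarrow> h z \<noteq> 0 \<Longrightarrow> F z = g z / h z"
    "\<And>z. z \<in> ball p 1 \<Longrightarrow> h z = 0 \<longleftrightarrow> (\<exists>j K. y z j K ^ q = 1)"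
proof -
  define V where "V = ball p 1"
  define R where "R = norm p + 1"
  have R: "R \<ge> 0" by (simp add: R_def)
  have zR: "norm (z $ i) \<le> R" if "z \<in> V" for z i
  proof -
    have "norm z \<le> norm p + norm (z - p)" by (metis add.commute diff_add_cancel norm_triangle_ineq)
    moreover have "norm (z - p) < 1" using that by (simp add: V_def dist_norm norm_minus_commute)
    ultimately show ?thesis using Finite_Cartesian_Product.norm_nth_le[of z i] by (simp add: R_def)
  qed
  \<comment> \<open>A tail sum has at most \<open>CARD('d)\<close> terms, each of norm at most
    \<open>R\<close> on \<open>V\<close>, so \<open>E\<close> bounds all the exponential factors
    there.\<close>
  define E where "E = exp (L * (CARD('d) * R))"
  have E: "E \<ge> 1" using L R by (simp add: E_def)
  have yE: "norm (y z j K) \<le> E * \<bar>\<rho>\<bar> ^ K" if "z \<in> V" for z j K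
  proof -
    have "norm (\<Sum>i\<in>{j..}. z $ i) \<le> (\<Sum>i\<in>{j..}. R)" by (intro sum_norm_le zR that)
    also have "\<dots> \<le> CARD('d) * R" using R by (auto intro!: mult_right_mono card_mono)
    finally have "norm (- of_real L * (\<Sum>i\<in>{j..}. z $ i)) \<le> L * (CARD('d) * R)"
      using L by (simp add: norm_mult)
    then have "norm (exp (- of_real L * (\<Sum>i\<in>{j..}. z $ i))) \<le> E"
      unfolding E_def by (intro order_trans[OF norm_exp]) simp
    then show ?thesis unfolding y_def by (simp add: norm_mult norm_power mult_right_mono)
  qed
  \<comment> \<open>From \<open>K = N\<close> on, \<open>norm (y z j K)\<close> is at most 1/2
    throughout \<open>V\<close>; hence these denominators neither vanish nor come close to
    0.\<close>
  obtain N where N: "\<bar>\<rho>\<bar> ^ N < 1 / (2 * E)"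
    using real_arch_pow_inv[of "1 / (2 * E)" "\<bar>\<rho>\<bar>"] \<rho> E by auto
  have small: "norm (y z j K ^ q) \<le> 1 / 2" if "z \<in> V" "K \<ge> N" for z j K
  proof -
    have "\<bar>\<rho>\<bar> ^ K \<le> \<bar>\<rho>\<bar> ^ N" using \<rho> that by (intro power_decreasing) auto
    then have "E * \<bar>\<rho>\<bar> ^ K \<le> E * (1 / (2 * E))" using N E by (intro mult_left_mono) auto
    then have le: "norm (y z j K) \<le> 1 / 2" using yE[OF that(1), of j K] E by simp
    have "norm (y z j K) ^ q \<le> norm (y z j K) ^ 1" using q le by (intro power_decreasing) auto
    then show ?thesis using le by (simp add: norm_power)
  qed
  have far: "y z j K ^ q \<noteq> 1" if "z \<in> V" "K \<ge> N" for z j K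
    using small[OF that, of j] by auto
  define T where "T = 1 + E ^ q"
  have T: "T \<ge> 1" using E by (simp add: T_def)
  have yT: "norm (1 - y z j K ^ q) \<le> T" if "z \<in> V" for z j K
  proof -
    have "norm (y z j K) \<le> E"
      using yE[OF that, of j K] mult_left_mono[of "\<bar>\<rho>\<bar> ^ K" 1 E] power_le_one[of "\<bar>\<rho>\<bar>" K] \<rho> E by linarith
    then have "norm (y z j K ^ q) \<le> E ^ q" by (simp add: norm_power power_mono)
    then show ?thesis using norm_triangle_ineq4[of 1 "y z j K ^ q"] by (simp add: T_def)
  qed
  \<comment> \<open>\<open>e z j K\<close> is the product of the first \<open>N\<close> factors
    divided by the factor of \<open>K\<close>, written so that it is defined at the poles too: for
    \<open>K < N\<close> the factor is omitted from the product, and otherwise it is invertible on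
    \<open>V\<close>.\<close>
  define e where "e = (\<lambda>z j K. (\<Prod>K'\<in>{..<N} - {K}. 1 - y z j K' ^ q) *
    (if K < N then 1 else inverse (1 - y z j K ^ q)))"
  define h where "h = (\<lambda>z. \<Prod>j\<in>UNIV. \<Prod>K<N. 1 - y z j K ^ q)"
  have e_mult: "e z j K * (1 - y z j K ^ q) = (\<Prod>K<N. 1 - y z j K ^ q)" if "z \<in> V" for z j K
  proof (cases "K < N")
    case True
    then have "(\<Prod>K<N. 1 - y z j K ^ q) = (1 - y z j K ^ q) * (\<Prod>K'\<in>{..<N} - {K}. 1 - y z j K' ^ q)"
      by (intro prod.remove) auto
    then show ?thesis using True by (simp add: e_def mult.commute)
  next
    case False
    then have "{..<N} - {K} = {..<N}" by auto
    then show ?thesis using False far[OF that, of K j] by (simp add: e_def)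
  qed
  have e_bound: "norm (e z j K) \<le> T ^ N * 2" if "z \<in> V" for z j K
    unfolding e_def norm_mult
  proof (rule mult_mono)
    have "norm (\<Prod>K'\<in>{..<N} - {K}. 1 - y z j K' ^ q) \<le> (\<Prod>K'\<in>{..<N} - {K}. T)"
      unfolding prod_norm[symmetric] by (intro prod_mono) (auto intro: yT that)
    also have "\<dots> \<le> T ^ N"
    proof -
      have "card ({..<N} - {K}) \<le> N" using card_mono[of "{..<N}" "{..<N} - {K}"] by auto
      then show ?thesis using T by (simp add: power_increasing)
    qed
    finally show "norm (\<Prod>K'\<in>{..<N} - {K}. 1 - y z j K' ^ q) \<le> T ^ N" .
    have "norm (inverse (1 - y z j K ^ q)) \<le> 2" if "\<not> K < N"
    proof -
      have "norm (1::complex) - norm (y z j K ^ q) \<le> norm (1 - y z j K ^ q)" by (rule norm_triangle_ineq2)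
      then have "1 / 2 \<le> norm (1 - y z j K ^ q)"
        using small[OF \<open>z \<in> V\<close>, of K j] that by simp
      then have "inverse (norm (1 - y z j K ^ q)) \<le> inverse (1 / 2)" by (intro le_imp_inverse_le) auto
      then show ?thesis by (simp add: norm_inverse)
    qed
    then show "norm (if K < N then 1 else inverse (1 - y z j K ^ q)) \<le> 2" by auto
  qed (use T in auto)
  define f where "f = (\<lambda>k z. coef z k * num (\<lambda>j. y z j (tail k j)) * (\<Prod>j\<in>UNIV. e z j (tail k j)))"
  define g where "g = (\<lambda>z. \<Sum>\<^sub>\<infinity>k. f k z)"
  define W where "W = (\<Sum>r\<in>UNIV \<rightarrow>\<^sub>E {..<q}. norm (w r)) * (E ^ q) ^ CARD('d)"
  have W: "W \<ge> 0" unfolding W_def using E by (intro mult_nonneg_nonneg sum_nonneg) auto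
  define M where "M = (\<lambda>k::'d \<Rightarrow> nat. W * (T ^ N * 2) ^ CARD('d) *
    (\<Prod>i\<in>UNIV. pochhammer R (k i) / fact (k i) * \<bar>\<rho>\<bar> ^ k i))"
  have fM: "norm (f k z) \<le> M k" if z: "z \<in> V" for k z
  proof -
    have "norm (f k z) = norm (coef z k) * norm (num (\<lambda>j. y z j (tail k j))) * (\<Prod>j\<in>UNIV. norm (e z j (tail k j)))"
      by (simp add: f_def norm_mult prod_norm)
    also have "\<dots> \<le> (\<Prod>i\<in>UNIV. pochhammer R (k i) / fact (k i)) * (W * (\<Prod>j\<in>UNIV. \<bar>\<rho>\<bar> ^ k j)) * (\<Prod>j\<in>(UNIV::'d set). T ^ N * 2)"
    proof (intro mult_mono)
      show "norm (coef z k) \<le> (\<Prod>i\<in>UNIV. pochhammer R (k i) / fact (k i))"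
        by (rule norm_coef_le) (rule zR[OF z])
      have "norm (num (\<lambda>j. y z j (tail k j))) \<le> W * (\<Prod>j\<in>UNIV. \<bar>\<rho>\<bar> ^ tail k j)"
        unfolding W_def by (rule norm_num_le[OF E yE[OF z]])
      also have "\<dots> \<le> W * (\<Prod>j\<in>UNIV. \<bar>\<rho>\<bar> ^ k j)" by (intro mult_left_mono prod_tail_le W)
      finally show "norm (num (\<lambda>j. y z j (tail k j))) \<le> W * (\<Prod>j\<in>UNIV. \<bar>\<rho>\<bar> ^ k j)" .
      show "(\<Prod>j\<in>UNIV. norm (e z j (tail k j))) \<le> (\<Prod>j\<in>(UNIV::'d set). T ^ N * 2)"
        by (intro prod_mono) (auto intro: e_bound[OF z])
    qed (auto intro!: prod_nonneg mult_nonneg_nonneg W pochhammer_real_nonneg R divide_nonneg_nonneg)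
    also have "\<dots> = M k" by (simp only: M_def prod.distrib prod_constant power_mult_distrib mult_ac)
    finally show ?thesis .
  qed
  have cdiff_factor: "cdiff_at (\<lambda>z. 1 - y z j K ^ q) z" for j K z
    by (intro cdiff_at_diff cdiff_at_const cdiff_at_power cdiff_at_y)
  have cdiff_e: "cdiff_at (\<lambda>z. e z j K) z" if "z \<in> V" for z j K
    unfolding e_def
  proof (intro cdiff_at_mult cdiff_at_prod cdiff_factor)
    show "cdiff_at (\<lambda>z. if K < N then 1 else inverse (1 - y z j K ^ q)) z"
    proof (cases "K < N")
      case False
      then have "1 - y z j K ^ q \<noteq> 0" using far[OF that, of K j] by simp
      then have "cdiff_at (\<lambda>z. inverse (1 - y z j K ^ q)) z"
        by (intro cdiff_at_inverse cdiff_factor)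
      with False show ?thesis by simp
    qed simp
  qed
  have cg: "cdiff_at g z" if "z \<in> V" for z
    unfolding g_def
  proof (rule cdiff_at_infsum[OF infinite_UNIV_index _ that _ fM])
    show "M summable_on UNIV" unfolding M_def by (intro summable_on_cmult_right summable_on_coef_bound R)
    show "cdiff_at (f k) z" if "z \<in> V" for k z
      unfolding f_def by (intro cdiff_at_mult cdiff_at_coef cdiff_at_num cdiff_at_prod cdiff_e that)
  qed (auto simp: V_def)
  have ch: "cdiff_at h z" for z
    unfolding h_def by (intro cdiff_at_prod cdiff_factor)
  have h0: "h z = 0 \<longleftrightarrow> (\<exists>j. \<exists>K<N. y z j K ^ q = 1)" for z
  proof -
    have "1 - c = 0 \<longleftrightarrow> c = 1" for c :: complex by auto
    then show ?thesis by (simp add: h_def Bex_def del: right_minus_eq)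
  qed
  have nz: "\<exists>z\<in>V. h z \<noteq> 0"
    using exists_nonpole_near[of p N] unfolding h0 V_def by blast
  have Fgh: "F z = g z / h z" if z: "z \<in> V" and "h z \<noteq> 0" for z
  proof -
    \<comment> \<open>Since \<open>h z\<close> is the product of the \<open>e z j (tail k j)\<close>
      and the denominators of the term, \<open>h z \<noteq> 0\<close> makes both nonzero and they
      may be cancelled.\<close>
    have "coef z k * num (\<lambda>j. y z j (tail k j)) / (\<Prod>j\<in>UNIV. 1 - y z j (tail k j) ^ q) = f k z * inverse (h z)" for k
    proof -
      have hz: "h z = (\<Prod>j\<in>UNIV. e z j (tail k j)) * (\<Prod>j\<in>UNIV. 1 - y z j (tail k j) ^ q)"
        unfolding h_def prod.distrib[symmetric] e_mult[OF z] ..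
      have cancel: "c / b = c * a * inverse (a * b)" if "a * b \<noteq> 0" for a b c :: complex
        using that by (simp add: field_simps)
      show ?thesis
        unfolding f_def hz by (rule cancel) (use \<open>h z \<noteq> 0\<close> hz in metis)
    qed
    then show ?thesis
      unfolding F_def g_def by (simp add: infsum_cmult_left' divide_inverse)
  qed
  have zero: "h z = 0 \<longleftrightarrow> (\<exists>j K. y z j K ^ q = 1)" if "z \<in> V" for z
    unfolding h0 using far[OF that] not_le by blast
  show ?thesis
    using cg ch nz Fgh zero unfolding V_def by (rule that)
qed

end

subsection \<open>Agreement with the series over increasing indices\<close>

text \<open>\<open>m\<close> records the gaps minus 1, so that all functions into the naturals are
  allowed and positivity and strict growth become automatic.\<close>

definition position :: "('d::{finite,linorder} \<Rightarrow> nat) \<Rightarrow> 'd \<Rightarrow> nat" where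
  "position m i = (\<Sum>l\<in>{..i}. Suc (m l))"

text \<open>The value 0 below the least index acts as the convention that the index sequence starts
  from 0, so the first gap is treated like the others.\<close>

definition previous :: "('d::{finite,linorder} \<Rightarrow> nat) \<Rightarrow> 'd \<Rightarrow> nat" where
  "previous n i = (if {..<i} = {} then 0 else n (Max {..<i}))"

lemma lessThan_eq_atMost_Max:
  fixes i :: "'d::{finite,linorder}"
  assumes "{..<i} \<noteq> {}"
  shows "{..<i} = {..Max {..<i}}" "Max {..<i} < i"
proof -
  show less: "Max {..<i} < i" using Max_in[of "{..<i}"] assms by simp
  show "{..<i} = {..Max {..<i}}"
  proof (intro set_eqI iffI)
    fix x assume "x \<in> {..<i}" then show "x \<in> {..Max {..<i}}" by simp
  next
    fix x assume "x \<in> {..Max {..<i}}" then show "x \<in> {..<i}" using less by simp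
  qed
qed

lemma position_previous: "position m i = previous (position m) i + Suc (m i)"
proof -
  have "{..i} = insert i {..<i}" by auto
  then have "position m i = Suc (m i) + (\<Sum>l\<in>{..<i}. Suc (m l))" by (simp add: position_def)
  also have "(\<Sum>l\<in>{..<i}. Suc (m l)) = previous (position m) i"
  proof (cases "{..<i} = {}")
    case True
    then show ?thesis by (simp add: previous_def)
  next
    case False
    then show ?thesis using lessThan_eq_atMost_Max(1)[OF False]
      by (simp only: previous_def position_def if_False)
  qed
  finally show ?thesis by simp
qed

text \<open>Partial sums are inverted by successive differences, lowered by 1.\<close>

lemma bij_betw_position:
  "bij_betw position (UNIV :: ('d::{finite,linorder} \<Rightarrow> nat) set) {n. strict_mono n \<and> (\<forall>i. 0 < n i)}"
proof (rule bij_betw_byWitness[where f' = "\<lambda>n i. n i - Suc (previous n i)"])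
  show "\<forall>m\<in>UNIV. (\<lambda>i. position m i - Suc (previous (position m) i)) = (m :: 'd \<Rightarrow> nat)"
  proof (intro ballI ext)
    show "position m i - Suc (previous (position m) i) = m i" for m and i :: 'd
      using position_previous[of m i] by linarith
  qed
  show "\<forall>n\<in>{n. strict_mono n \<and> (\<forall>i. 0 < n i)}. position (\<lambda>i. n i - Suc (previous n i)) = (n :: 'd \<Rightarrow> nat)"
  proof (intro ballI ext)
    fix n :: "'d \<Rightarrow> nat" and i :: 'd
    assume "n \<in> {n. strict_mono n \<and> (\<forall>i. 0 < n i)}"
    then have n: "strict_mono n" "\<And>i. 0 < n i" by auto
    have less: "previous n i < n i" for i
      using n lessThan_eq_atMost_Max(2)[of i] by (auto simp: previous_def strict_mono_def)
    show "position (\<lambda>i. n i - Suc (previous n i)) i = n i"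
    \<comment> \<open>The index type is only a finite linear order, so the induction is on the
      number of smaller indices.\<close>
    proof (induction i rule: measure_induct_rule[of "\<lambda>i. card {..<i}"])
      case (less i)
      let ?m = "\<lambda>i. n i - Suc (previous n i)"
      have "previous (position ?m) i = previous n i"
      proof (cases "{..<i} = {}")
        case False
        have "Max {..<i} < i" using lessThan_eq_atMost_Max(2)[OF False] .
        then have "{..<Max {..<i}} \<subset> {..<i}" by (auto simp: psubset_eq set_eq_iff intro: order.strict_trans)
        then have "card {..<Max {..<i}} < card {..<i}" by (intro psubset_card_mono) auto
        with less.IH False show ?thesis by (simp add: previous_def)
      qed (simp add: previous_def)
      then show ?case using position_previous[of ?m i] \<open>\<And>i. previous n i < n i\<close>[of i] by simp
    qed
  qed
  show "position ` UNIV \<subseteq> {n. strict_mono n \<and> (\<forall>i::'d. 0 < n i)}"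
  proof clarify
    fix m :: "'d \<Rightarrow> nat"
    have "position m i < position m j" if "i < j" for i j
      unfolding position_def by (rule sum_strict_mono2[where b = j]) (use that in auto)
    moreover have "0 < position m i" for i
      using position_previous[of m i] by simp
    ultimately show "strict_mono (position m) \<and> (\<forall>i. 0 < position m i)" by (simp add: strict_mono_def)
  qed
qed auto

lemma summable_on_mult_Times:
  fixes f :: "'a \<Rightarrow> real" and g :: "'b \<Rightarrow> real"
  assumes "f summable_on A" "g summable_on B" "\<And>x. f x \<ge> 0" "\<And>x. g x \<ge> 0"
  shows "(\<lambda>(x, y). f x * g y) summable_on A \<times> B"
proof (rule summable_on_SigmaI[where g = "\<lambda>x. f x * infsum g B"])
  show "((\<lambda>y. case (x, y) of (x, y) \<Rightarrow> f x * g y) has_sum f x * infsum g B) B" for x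
    using has_sum_cmult_right[OF has_sum_infsum[OF assms(2)]] by simp
  show "(\<lambda>x. f x * infsum g B) summable_on A" by (rule summable_on_cmult_left[OF assms(1)])
qed (use assms in auto)

lemma has_sum_geometric_complex:
  fixes z :: complex
  assumes "norm z < 1"
  shows "((\<lambda>n. z ^ n) has_sum 1 / (1 - z)) UNIV"
  using assms by (intro norm_summable_imp_has_sum geometric_sums) (simp_all add: norm_power summable_geometric)

section \<open>Geometric series with periodic weights and the exchange of summations\<close>

context lucas_continuation begin

text \<open>By periodicity each value of \<open>w\<close> is attained at a reduced residue vector,
  and there are finitely many of these.\<close>

lemma norm_weight_le: "norm (w m) \<le> (\<Sum>r\<in>UNIV \<rightarrow>\<^sub>E {..<q}. norm (w r))"
proof -
  have "w m = w (\<lambda>j. m j mod q)"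
    using periodic[of "\<lambda>j. m j mod q" "\<lambda>j. m j div q"] by simp
  moreover have "(\<lambda>j. m j mod q) \<in> UNIV \<rightarrow>\<^sub>E {..<q}" using q by (auto simp: PiE_iff)
  ultimately show ?thesis
    using member_le_sum[of "\<lambda>j. m j mod q" "UNIV \<rightarrow>\<^sub>E {..<q}" "\<lambda>r. norm (w r)"] finite_box by simp
qed

lemma bij_betw_residue:
  "bij_betw (\<lambda>(r, t) j. r j + q * t j) ((UNIV \<rightarrow>\<^sub>E {..<q}) \<times> UNIV) (UNIV :: ('d \<Rightarrow> nat) set)"
proof (rule bij_betw_byWitness[where f' = "\<lambda>m. (\<lambda>j. m j mod q, \<lambda>j. m j div q)"])
  show "\<forall>a\<in>(UNIV \<rightarrow>\<^sub>E {..<q}) \<times> UNIV.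
    (\<lambda>j. (case a of (r, t) \<Rightarrow> \<lambda>j. r j + q * t j) j mod q, \<lambda>j. (case a of (r, t) \<Rightarrow> \<lambda>j. r j + q * t j) j div q) = a"
    using q by (auto simp: PiE_iff fun_eq_iff)
qed (use q in \<open>auto simp: PiE_iff\<close>)

lemma summable_on_powers:
  assumes "\<And>j::'d. norm (x j :: complex) < 1"
  shows "(\<lambda>m. \<Prod>j\<in>(UNIV::'d set). norm (x j) ^ Suc (m j)) summable_on UNIV"
proof (rule summable_on_prod_fun)
  show "(\<lambda>n. norm (x j) ^ Suc n) summable_on UNIV" for j
    using assms[of j] by (intro norm_summable_imp_summable_on) (simp add: summable_geometric summable_mult)
qed auto

text \<open>Division with remainder in each coordinate writes \<open>m\<close> as
  \<open>r + q t\<close>. The weight depends on \<open>r\<close> alone, and the sum over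
  \<open>t\<close> is a product of geometric series with ratios \<open>x j ^ q\<close>.\<close>

lemma infsum_weighted_powers:
  assumes x: "\<And>j. norm (x j) < 1"
  shows "(\<Sum>\<^sub>\<infinity>m. w m * (\<Prod>j\<in>UNIV. x j ^ Suc (m j))) = num x / (\<Prod>j\<in>UNIV. 1 - x j ^ q)"
proof -
  define f where "f = (\<lambda>m. w m * (\<Prod>j\<in>UNIV. x j ^ Suc (m j)))"
  define W where "W = (\<Sum>r\<in>UNIV \<rightarrow>\<^sub>E {..<q}. norm (w r))"
  have "(\<lambda>m. norm (f m)) summable_on UNIV"
  proof (rule Infinite_Sum.abs_summable_on_comparison_test')
    show "(\<lambda>m. W * (\<Prod>j\<in>UNIV. norm (x j) ^ Suc (m j))) summable_on UNIV"
      by (intro summable_on_cmult_right summable_on_powers x)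
    show "norm (f m) \<le> W * (\<Prod>j\<in>UNIV. norm (x j) ^ Suc (m j))" for m
      unfolding f_def norm_mult prod_norm[symmetric] norm_power W_def
      by (intro mult_right_mono norm_weight_le prod_nonneg) auto
  qed
  then have "f summable_on UNIV" by (rule abs_summable_summable)
  then have summable: "(\<lambda>(r, t). f (\<lambda>j. r j + q * t j)) summable_on (UNIV \<rightarrow>\<^sub>E {..<q}) \<times> UNIV"
    using summable_on_reindex_bij_betw[OF bij_betw_residue, of f] by (simp add: case_prod_unfold)
  have xq: "norm (x j ^ q) < 1" for j
    using x[of j] q by (simp add: norm_power power_less_one_iff)
  have inner: "(\<Sum>\<^sub>\<infinity>t. f (\<lambda>j. r j + q * t j)) = w r * (\<Prod>j\<in>UNIV. x j ^ Suc (r j)) / (\<Prod>j\<in>UNIV. 1 - x j ^ q)" for r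
  proof -
    have "f (\<lambda>j. r j + q * t j) = w r * (\<Prod>j\<in>UNIV. x j ^ Suc (r j)) * (\<Prod>j\<in>UNIV. (x j ^ q) ^ t j)" for t
      unfolding f_def periodic by (simp add: power_add power_mult prod.distrib mult_ac)
    then have "(\<Sum>\<^sub>\<infinity>t. f (\<lambda>j. r j + q * t j)) =
        w r * (\<Prod>j\<in>UNIV. x j ^ Suc (r j)) * (\<Sum>\<^sub>\<infinity>t. \<Prod>j\<in>UNIV. (x j ^ q) ^ t j)"
      by (simp add: infsum_cmult_right')
    also have "(\<Sum>\<^sub>\<infinity>t. \<Prod>j\<in>UNIV. (x j ^ q) ^ t j) = (\<Prod>j\<in>UNIV. \<Sum>\<^sub>\<infinity>n. (x j ^ q) ^ n)"
    proof (rule infsum_prod_fun)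
      show "(\<lambda>n. norm ((x j ^ q) ^ n)) summable_on UNIV" for j
        using xq[of j] by (intro norm_summable_imp_summable_on) (simp add: norm_power summable_geometric)
    qed
    also have "\<dots> = 1 / (\<Prod>j\<in>UNIV. 1 - x j ^ q)"
      using infsumI[OF has_sum_geometric_complex[OF xq]] by (simp add: prod_dividef)
    finally show ?thesis by simp
  qed
  have "(\<Sum>\<^sub>\<infinity>m. f m) = (\<Sum>\<^sub>\<infinity>(r, t)\<in>(UNIV \<rightarrow>\<^sub>E {..<q}) \<times> UNIV. f (\<lambda>j. r j + q * t j))"
    using infsum_reindex_bij_betw[OF bij_betw_residue, of f] by (simp add: case_prod_unfold)
  also have "\<dots> = (\<Sum>\<^sub>\<infinity>r\<in>UNIV \<rightarrow>\<^sub>E {..<q}. \<Sum>\<^sub>\<infinity>t. f (\<lambda>j. r j + q * t j))"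
    using infsum_Sigma_banach[OF summable] by simp
  also have "\<dots> = num x / (\<Prod>j\<in>UNIV. 1 - x j ^ q)"
    unfolding inner by (simp add: infsum_finite[OF finite_box] num_def sum_divide_distrib)
  finally show ?thesis by (simp add: f_def)
qed

text \<open>Each \<open>y s l (tail k l)\<close> is a product over \<open>i \<ge> l\<close> of
  factors \<open>c i\<close>. Exchanging the products, \<open>c i\<close> collects the gaps up to
  \<open>i\<close> as its exponent, which is \<open>position m i\<close>.\<close>

lemma prod_y_eq:
  "(\<Prod>l\<in>UNIV. y s l (tail k l) ^ Suc (m l)) =
   (\<Prod>i\<in>UNIV. (of_real \<rho> ^ position m i) ^ k i * exp (- of_real L * s $ i * of_nat (position m i)))"
proof -
  define c where "c = (\<lambda>i. exp (- of_real L * s $ i) * of_real \<rho> ^ k i)"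
  have "y s l (tail k l) = (\<Prod>i\<in>{i \<in> UNIV. l \<le> i}. c i)" for l
    by (simp add: y_def tail_def c_def prod.distrib exp_sum sum_distrib_left power_sum atLeast_def)
  then have "(\<Prod>l\<in>UNIV. y s l (tail k l) ^ Suc (m l)) = (\<Prod>l\<in>UNIV. \<Prod>i\<in>{i \<in> UNIV. l \<le> i}. c i ^ Suc (m l))"
    by (simp only: prod_power_distrib)
  also have "\<dots> = (\<Prod>i\<in>UNIV. \<Prod>l\<in>{l \<in> UNIV. l \<le> i}. c i ^ Suc (m l))"
    by (rule prod.swap_restrict) auto
  also have "\<dots> = (\<Prod>i\<in>UNIV. c i ^ position m i)"
    by (simp only: power_sum[symmetric] position_def atMost_def UNIV_I simp_thms)
  also have "\<dots> = (\<Prod>i\<in>UNIV. (of_real \<rho> ^ position m i) ^ k i * exp (- of_real L * s $ i * of_nat (position m i)))"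
  proof (intro prod.cong refl)
    show "c i ^ position m i = (of_real \<rho> ^ position m i) ^ k i * exp (- of_real L * s $ i * of_nat (position m i))" for i
      unfolding c_def power_mult_distrib
      by (simp add: exp_of_nat_mult[symmetric] power_mult[symmetric] mult_ac)
  qed
  finally show ?thesis .
qed

text \<open>Both sides are iterated sums of one absolutely convergent double series over
  \<open>k\<close> and \<open>m\<close>: summing over \<open>m\<close> first gives the geometric
  form, summing over \<open>k\<close> first gives the binomial powers.\<close>

lemma F_eq:
  assumes s: "\<And>j. 0 < (\<Sum>i\<in>{j..}. Re (s $ i))"
  shows "F s = (\<Sum>\<^sub>\<infinity>m. w m * (\<Prod>i\<in>UNIV. exp (- of_real L * s $ i * of_nat (position m i)) *
           (1 - of_real \<rho> ^ position m i) powr (- s $ i)))"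
proof -
  define Y where "Y = (\<lambda>j. exp (- of_real L * (\<Sum>i\<in>{j..}. s $ i)))"
  \<comment> \<open>This is where membership in the domain of convergence enters.\<close>
  have Y: "norm (Y j) < 1" for j using s[of j] L by (simp add: Y_def)
  have yY: "norm (y s j K) = norm (Y j) * \<bar>\<rho>\<bar> ^ K" for j K
    by (simp add: y_def Y_def norm_mult norm_power)
  have y1: "norm (y s j K) < 1" for j K
    using mult_left_mono[of "\<bar>\<rho>\<bar> ^ K" 1 "norm (Y j)"] power_le_one[of "\<bar>\<rho>\<bar>" K] \<rho> Y[of j]
    unfolding yY by simp
  define R where "R = norm s"
  have R: "R \<ge> 0" by (simp add: R_def)
  define W where "W = (\<Sum>r\<in>UNIV \<rightarrow>\<^sub>E {..<q}. norm (w r))"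
  have W: "W \<ge> 0" by (auto simp: W_def intro: sum_nonneg)
  define f where "f = (\<lambda>k m. coef s k * (w m * (\<Prod>l\<in>UNIV. y s l (tail k l) ^ Suc (m l))))"
  define B where "B = (\<lambda>k::'d \<Rightarrow> nat. W * (\<Prod>i\<in>UNIV. pochhammer R (k i) / fact (k i) * \<bar>\<rho>\<bar> ^ k i))"
  define G where "G = (\<lambda>m::'d \<Rightarrow> nat. \<Prod>j\<in>UNIV. norm (Y j) ^ Suc (m j))"
  have poch: "(\<Prod>i\<in>(UNIV::'d set). pochhammer R (k i) / fact (k i)) \<ge> 0" for k
    by (intro prod_nonneg divide_nonneg_nonneg pochhammer_real_nonneg R) auto
  \<comment> \<open>The majorant separates the variables: one power of
    \<open>\<bar>\<rho>\<bar> ^ tail k l\<close> is kept for the sum over \<open>k\<close>, all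
    powers of \<open>norm (Y l)\<close> for the sum over \<open>m\<close>.\<close>
  have bound: "norm (f k m) \<le> B k * G m" for k m
  proof -
    have "(\<Prod>l\<in>UNIV. norm (y s l (tail k l)) ^ Suc (m l)) \<le> (\<Prod>l\<in>UNIV. norm (Y l) ^ Suc (m l) * \<bar>\<rho>\<bar> ^ tail k l)"
    proof (intro prod_mono conjI)
      fix l
      have "(\<bar>\<rho>\<bar> ^ tail k l) ^ Suc (m l) \<le> (\<bar>\<rho>\<bar> ^ tail k l) ^ 1"
        using \<rho> by (intro power_decreasing) (auto intro: power_le_one)
      then show "norm (y s l (tail k l)) ^ Suc (m l) \<le> norm (Y l) ^ Suc (m l) * \<bar>\<rho>\<bar> ^ tail k l"
        unfolding yY power_mult_distrib by (intro mult_left_mono) auto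
    qed auto
    also have "\<dots> = G m * (\<Prod>l\<in>UNIV. \<bar>\<rho>\<bar> ^ tail k l)" by (simp only: prod.distrib G_def)
    also have "\<dots> \<le> G m * (\<Prod>l\<in>UNIV. \<bar>\<rho>\<bar> ^ k l)"
      by (intro mult_left_mono prod_tail_le) (auto simp: G_def intro!: prod_nonneg)
    finally have le: "(\<Prod>l\<in>UNIV. norm (y s l (tail k l)) ^ Suc (m l)) \<le> G m * (\<Prod>l\<in>UNIV. \<bar>\<rho>\<bar> ^ k l)" .
    have "norm (f k m) = norm (coef s k) * (norm (w m) * (\<Prod>l\<in>UNIV. norm (y s l (tail k l)) ^ Suc (m l)))"
      by (simp only: f_def norm_mult prod_norm[symmetric] norm_power)
    also have "\<dots> \<le> (\<Prod>i\<in>UNIV. pochhammer R (k i) / fact (k i)) * (W * (G m * (\<Prod>l\<in>UNIV. \<bar>\<rho>\<bar> ^ k l)))"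
      using norm_weight_le[of m] norm_coef_le[of s R k] le poch W
      by (intro mult_mono mult_nonneg_nonneg)
        (auto simp: W_def R_def Finite_Cartesian_Product.norm_nth_le intro!: prod_nonneg)
    also have "\<dots> = B k * G m" by (simp only: B_def prod.distrib mult_ac)
    finally show ?thesis .
  qed
  have "(\<lambda>(k, m). B k * G m) summable_on UNIV \<times> UNIV"
  proof (rule summable_on_mult_Times)
    show "B summable_on UNIV" unfolding B_def by (intro summable_on_cmult_right summable_on_coef_bound R)
    show "G summable_on UNIV" unfolding G_def by (rule summable_on_powers[OF Y])
    show "B k \<ge> 0" for k
      unfolding B_def by (intro mult_nonneg_nonneg W prod_nonneg ballI divide_nonneg_nonneg pochhammer_real_nonneg R) auto
    show "G m \<ge> 0" for m unfolding G_def by (intro prod_nonneg) auto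
  qed
  then have "(\<lambda>x. norm (case x of (k, m) \<Rightarrow> f k m)) summable_on UNIV \<times> UNIV"
    by (rule Infinite_Sum.abs_summable_on_comparison_test') (use bound in auto)
  then have summable: "(\<lambda>(k, m). f k m) summable_on UNIV \<times> UNIV"
    by (rule abs_summable_summable)
  have inner: "(\<Sum>\<^sub>\<infinity>k. f k m) = w m * (\<Prod>i\<in>UNIV. exp (- of_real L * s $ i * of_nat (position m i)) *
           (1 - of_real \<rho> ^ position m i) powr (- s $ i))" for m
  proof -
    define n where "n = position m"
    define c where "c = (\<lambda>i K. exp (- of_real L * s $ i * of_nat (n i)) *
      (pochhammer (s $ i) K / fact K * (of_real \<rho> ^ n i) ^ K))"
    have "n i > 0" for i using position_previous[of m i] by (simp add: n_def)
    then have pow: "\<bar>\<rho>\<bar> ^ n i < 1" for i using \<rho> by (simp add: power_less_one_iff)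
    then have pow': "norm (of_real \<rho> ^ n i :: complex) < 1" for i by (simp add: norm_power)
    have c_sums: "c i sums (exp (- of_real L * s $ i * of_nat (n i)) * (1 - of_real \<rho> ^ n i) powr (- s $ i))" for i
      unfolding c_def by (intro sums_mult sums_pochhammer_complex pow')
    have c_abs: "(\<lambda>K. norm (c i K)) summable_on UNIV" for i
    proof (rule Infinite_Sum.abs_summable_on_comparison_test')
      show "(\<lambda>K. norm (exp (- of_real L * s $ i * of_nat (n i))) *
          (pochhammer (norm (s $ i)) K / fact K * (\<bar>\<rho>\<bar> ^ n i) ^ K)) summable_on UNIV"
        using pow[of i] by (intro summable_on_cmult_right summable_on_pochhammer_real) auto
      show "norm (c i K) \<le> norm (exp (- of_real L * s $ i * of_nat (n i))) *
          (pochhammer (norm (s $ i)) K / fact K * (\<bar>\<rho>\<bar> ^ n i) ^ K)" for K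
        unfolding c_def norm_mult norm_divide norm_power norm_of_real norm_fact
        by (intro mult_left_mono mult_right_mono divide_right_mono norm_pochhammer_le) auto
    qed
    have "f k m = w m * (\<Prod>i\<in>UNIV. c i (k i))" for k
      by (simp only: f_def prod_y_eq coef_def c_def n_def prod.distrib mult_ac)
    then have "(\<Sum>\<^sub>\<infinity>k. f k m) = w m * (\<Prod>i\<in>UNIV. infsum (c i) UNIV)"
      using infsum_prod_fun[of c, OF c_abs] by (simp add: infsum_cmult_right')
    also have "\<dots> = w m * (\<Prod>i\<in>UNIV. exp (- of_real L * s $ i * of_nat (n i)) * (1 - of_real \<rho> ^ n i) powr (- s $ i))"
      using sums_unique2[OF has_sum_imp_sums[OF has_sum_infsum[OF abs_summable_summable[OF c_abs]]] c_sums]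
      by simp
    finally show ?thesis by (simp only: n_def)
  qed
  have "F s = (\<Sum>\<^sub>\<infinity>k. \<Sum>\<^sub>\<infinity>m. f k m)"
    unfolding F_def f_def using infsum_weighted_powers[OF y1] by (simp add: infsum_cmult_right')
  also have "\<dots> = (\<Sum>\<^sub>\<infinity>m. \<Sum>\<^sub>\<infinity>k. f k m)"
    by (rule infsum_swap_banach[OF summable])
  finally show ?thesis unfolding inner .
qed

end

subsection \<open>Poles\<close>

lemma meromorphic_several_on_mult:
  assumes g: "holomorphic_several_on g S" and f: "meromorphic_several_on f S"
  shows "meromorphic_several_on (\<lambda>z. g z * f z) S"
  unfolding meromorphic_several_on_def
proof (intro conjI ballI)
  show "open S" using g by (simp add: holomorphic_several_on_iff)
  fix p assume "p \<in> S"
  then obtain V u v where V: "open V" "connected V" "p \<in> V" "V \<subseteq> S"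
    and u: "holomorphic_several_on u V" and v: "holomorphic_several_on v V"
    and nz: "\<exists>z\<in>V. v z \<noteq> 0" and quot: "\<forall>z\<in>V. v z \<noteq> 0 \<longrightarrow> f z = u z / v z"
    using f unfolding meromorphic_several_on_def by (elim conjE) (drule (1) bspec, blast)
  have "holomorphic_several_on (\<lambda>z. g z * u z) V"
    using g u V(4) unfolding holomorphic_several_on_iff by (auto intro!: cdiff_at_mult)
  then show "\<exists>V u v. open V \<and> connected V \<and> p \<in> V \<and> V \<subseteq> S \<and>
      holomorphic_several_on u V \<and> holomorphic_several_on v V \<and>
      (\<exists>z\<in>V. v z \<noteq> 0) \<and> (\<forall>z\<in>V. v z \<noteq> 0 \<longrightarrow> g z * f z = u z / v z)"
    using V v nz quot by (intro exI[of _ V] exI[of _ "\<lambda>z. g z * u z"] exI[of _ v]) simp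
qed

lemma cdiff_at_imp_isCont: "cdiff_at f z \<Longrightarrow> isCont f z"
  unfolding cdiff_at_def using has_derivative_continuous by blast

context lucas_continuation begin

lemma meromorphic_several_on_F: "meromorphic_several_on F UNIV"
  unfolding meromorphic_several_on_def
proof (intro conjI ballI)
  fix p
  obtain g h where gh: "\<And>z. z \<in> ball p 1 \<Longrightarrow> cdiff_at g z" "\<And>z. z \<in> ball p 1 \<Longrightarrow> cdiff_at h z"
    and nz: "\<exists>z\<in>ball p 1. h z \<noteq> 0" and quot: "\<And>z. z \<in> ball p 1 \<Longrightarrow> h z \<noteq> 0 \<Longrightarrow> F z = g z / h z"
    and "\<And>z. z \<in> ball p 1 \<Longrightarrow> h z = 0 \<longleftrightarrow> (\<exists>j K. y z j K ^ q = 1)"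
    by (rule F_local_quotient[of p]) blast
  have "holomorphic_several_on g (ball p 1)" "holomorphic_several_on h (ball p 1)"
    using gh by (simp_all add: holomorphic_several_on_iff)
  then show "\<exists>V g h. open V \<and> connected V \<and> p \<in> V \<and> V \<subseteq> UNIV \<and>
      holomorphic_several_on g V \<and> holomorphic_several_on h V \<and>
      (\<exists>z\<in>V. h z \<noteq> 0) \<and> (\<forall>z\<in>V. h z \<noteq> 0 \<longrightarrow> F z = g z / h z)"
    using nz quot by (intro exI[of _ "ball p 1"] exI[of _ g] exI[of _ h]) simp
qed simp

text \<open>Inside a unit ball the zero set of the local denominator \<open>h\<close> is exactly the
  pole set. Continuity of \<open>h\<close> therefore also shows that the complement of the pole set
  is open.\<close>

lemma holomorphic_several_on_F: "holomorphic_several_on F (- {s. \<exists>j K. y s j K ^ q = 1})"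
proof -
  define S where "S = - {s. \<exists>j K. y s j K ^ q = 1}"
  have "\<exists>U. open U \<and> p \<in> U \<and> U \<subseteq> S \<and> cdiff_at F p" if p: "p \<in> S" for p
  proof -
    obtain g h where gh: "\<And>z. z \<in> ball p 1 \<Longrightarrow> cdiff_at g z" "\<And>z. z \<in> ball p 1 \<Longrightarrow> cdiff_at h z"
      and "\<exists>z\<in>ball p 1. h z \<noteq> 0"
      and quot: "\<And>z. z \<in> ball p 1 \<Longrightarrow> h z \<noteq> 0 \<Longrightarrow> F z = g z / h z"
      and zero: "\<And>z. z \<in> ball p 1 \<Longrightarrow> h z = 0 \<longleftrightarrow> (\<exists>j K. y z j K ^ q = 1)"
      by (rule F_local_quotient[of p]) blast
    define U where "U = ball p 1 \<inter> h -` (- {0})"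
    have "continuous_on (ball p 1) h"
      using gh(2) by (intro continuous_at_imp_continuous_on ballI cdiff_at_imp_isCont)
    then have "open U" unfolding U_def by (intro continuous_open_preimage) auto
    have US: "U \<subseteq> S" using zero by (auto simp: U_def S_def)
    have pU: "p \<in> U" using zero[of p] p by (auto simp: U_def S_def)
    have "cdiff_at (\<lambda>z. g z / h z) p"
      using pU gh by (intro cdiff_at_divide) (auto simp: U_def)
    then have "cdiff_at F p"
      by (rule cdiff_at_transform[OF _ \<open>open U\<close> pU]) (use quot in \<open>auto simp: U_def\<close>)
    with \<open>open U\<close> pU US show ?thesis by blast
  qed
  then have "open S" "\<forall>p\<in>S. cdiff_at F p"
    using open_subopen[of S] by blast+
  then show ?thesis unfolding S_def[symmetric] holomorphic_several_on_iff by blast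
qed

text \<open>With a logarithm \<open>\<theta>\<close> of \<open>\<rho>\<close> the left side says
  that an exponential is 1, so its exponent is an integral multiple of 2 pi i. A negative
  \<open>\<rho>\<close> adds pi i to \<open>\<theta>\<close>, which is the origin of
  \<open>lucas_ell\<close>.\<close>

lemma y_power_eq_1_iff:
  assumes "\<rho> \<noteq> 0"
  shows "y s j K ^ q = 1 \<longleftrightarrow> (\<exists>n::int. (\<Sum>i\<in>{j..}. s $ i) =
    of_nat K * of_real (ln \<bar>\<rho>\<bar> / L) +
    (2 * of_int n / of_nat q + of_nat (lucas_ell \<rho> K)) * (of_real pi * \<i> / of_real L))"
proof -
  define \<theta> :: complex where "\<theta> = of_real (ln \<bar>\<rho>\<bar>) + (if \<rho> < 0 then of_real pi * \<i> else 0)"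
  have "exp \<theta> = of_real \<rho>"
    using assms by (auto simp: \<theta>_def exp_add exp_of_real exp_pi_i mult.commute[of _ \<i>] simp flip: of_real_minus)
  then have "y s j K ^ q = exp (of_nat q * (- of_real L * (\<Sum>i\<in>{j..}. s $ i) + of_nat K * \<theta>))"
    by (simp only: y_def exp_add exp_of_nat_mult)
  also have "\<dots> = 1 \<longleftrightarrow> (\<exists>n::int. of_nat q * (- of_real L * (\<Sum>i\<in>{j..}. s $ i) + of_nat K * \<theta>) = of_int (2 * n) * of_real pi * \<i>)"
    using exp_eq[of _ 0] by simp
  \<comment> \<open>The sum carries the coefficient \<open>- L\<close>, so replacing
    \<open>n\<close> by \<open>- n\<close> gives the sign of the hyperplane equation.\<close>
  also have "\<dots> \<longleftrightarrow> (\<exists>n::int. of_nat q * (- of_real L * (\<Sum>i\<in>{j..}. s $ i) + of_nat K * \<theta>) = of_int (2 * (- n)) * of_real pi * \<i>)"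
    by (metis minus_minus)
  also have "\<dots> \<longleftrightarrow> (\<exists>n::int. (\<Sum>i\<in>{j..}. s $ i) =
    of_nat K * of_real (ln \<bar>\<rho>\<bar> / L) +
    (2 * of_int n / of_nat q + of_nat (lucas_ell \<rho> K)) * (of_real pi * \<i> / of_real L))"
  proof (intro arg_cong[of _ _ Ex] ext)
    fix n :: int
    have \<theta>: "of_nat K * \<theta> = of_nat K * of_real (ln \<bar>\<rho>\<bar>) + of_nat (lucas_ell \<rho> K) * (of_real pi * \<i>)"
      by (simp add: \<theta>_def lucas_ell_def algebra_simps)
    have "S = of_nat K * of_real (ln \<bar>\<rho>\<bar> / L) + (2 * of_int n / of_nat q + of_nat e) * (of_real pi * \<i> / of_real L)
      \<longleftrightarrow> of_nat q * (- of_real L * S + (of_nat K * of_real (ln \<bar>\<rho>\<bar>) + of_nat e * (of_real pi * \<i>))) = of_int (2 * (- n)) * of_real pi * \<i>"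
      for S :: complex and e :: nat
      using L q by (auto simp: field_simps)
    then show "(of_nat q * (- of_real L * (\<Sum>i\<in>{j..}. s $ i) + of_nat K * \<theta>) = of_int (2 * (- n)) * of_real pi * \<i>) =
      ((\<Sum>i\<in>{j..}. s $ i) = of_nat K * of_real (ln \<bar>\<rho>\<bar> / L) +
        (2 * of_int n / of_nat q + of_nat (lucas_ell \<rho> K)) * (of_real pi * \<i> / of_real L))"
      unfolding \<theta> by metis
  qed
  finally show ?thesis .
qed

end

section \<open>The roots and the powers of the Lucas numbers\<close>

lemma lucas_roots:
  assumes "P > 0" "Q \<noteq> 0" "P \<le> 2 \<Longrightarrow> Q < P - 1" "P > 2 \<Longrightarrow> Q \<le> P - 1"
  shows "lucas_alpha P Q > 1" "\<bar>lucas_beta P Q\<bar> < lucas_alpha P Q"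
    "lucas_alpha P Q * lucas_beta P Q = Q"
proof -
  define D where "D = P\<^sup>2 - 4 * Q"
  \<comment> \<open>The bound on \<open>Q\<close> thus compares \<open>D\<close> with
    \<open>(P - 2)\<^sup>2\<close>. For \<open>P \<le> 2\<close> it must be strict to give
    \<open>sqrt D > 2 - P\<close>; for \<open>P > 2\<close> positivity of \<open>D\<close> is
    enough.\<close>
  have eq: "P\<^sup>2 - 4 * (P - 1) = (P - 2)\<^sup>2" by (simp add: power2_eq_square algebra_simps)
  have "D > 0 \<and> P + sqrt D > 2"
  proof (cases "P \<le> 2")
    case True
    then have D: "(2 - P)\<^sup>2 < D" using assms(3) eq by (simp add: D_def power2_commute)
    then have "2 - P < sqrt D" by (rule real_less_rsqrt)
    moreover have "0 \<le> (2 - P)\<^sup>2" by simp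
    ultimately show ?thesis using D by linarith
  next
    case False
    then have D: "(P - 2)\<^sup>2 \<le> D" using assms(4) eq by (simp add: D_def)
    moreover have "0 < (P - 2)\<^sup>2" using False by simp
    ultimately have "D > 0" by linarith
    then show ?thesis using False real_sqrt_gt_zero[of D] by linarith
  qed
  then have D: "D > 0" "P + sqrt D > 2" "sqrt D > 0" by auto
  show "lucas_alpha P Q > 1" using D by (simp add: lucas_alpha_def D_def)
  show "\<bar>lucas_beta P Q\<bar> < lucas_alpha P Q"
    unfolding lucas_alpha_def lucas_beta_def D_def[symmetric]
    using D assms(1) by (simp add: abs_if field_simps)
  have "(P + sqrt D) * (P - sqrt D) = P\<^sup>2 - (sqrt D)\<^sup>2" by (simp add: power2_eq_square algebra_simps)
  then show "lucas_alpha P Q * lucas_beta P Q = Q"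
    using D(1) by (simp add: lucas_alpha_def lucas_beta_def flip: D_def) (simp add: D_def)
qed

lemma dirichlet_character_periodic:
  assumes "dirichlet_character q f"
  shows "f (a + int (q * t)) = f a"
proof (induction t)
  case (Suc t)
  have "f (a + int (q * Suc t)) = f ((a + int (q * t)) + int q)" by (simp add: algebra_simps)
  also have "\<dots> = f (a + int (q * t))" using assms unfolding dirichlet_character_def by metis
  finally show ?case using Suc by simp
qed simp

lemma powr_of_real_eq_exp: "x > 0 \<Longrightarrow> complex_of_real x powr s = exp (s * of_real (ln x))"
  by (simp add: powr_def Ln_of_real)

text \<open>The factors \<open>a ^ n\<close>, \<open>1 - (b / a) ^ n\<close> and
  \<open>a - b\<close> are positive reals, so their real logarithms add up and no branch of the
  power interferes.\<close>

lemma inverse_lucas_U_powr: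
  assumes "a > 1" "\<bar>b\<bar> < a" "n > 0"
  shows "1 / complex_of_real ((a ^ n - b ^ n) / (a - b)) powr s =
    exp (s * of_real (ln (a - b))) * (exp (- of_real (ln a) * s * of_nat n) * (1 - of_real (b / a) ^ n) powr (- s))"
proof -
  have less: "\<bar>b / a\<bar> ^ n < 1" using assms by (simp add: power_less_one_iff)
  then have pos: "0 < 1 - (b / a) ^ n" by (metis abs_le_D1 diff_gt_0_iff_gt not_le power_abs order_le_less_trans abs_ge_self)
  have ab: "a - b > 0" using assms by linarith
  have eq: "(a ^ n - b ^ n) / (a - b) = a ^ n * (1 - (b / a) ^ n) / (a - b)"
    using assms by (simp add: power_divide right_diff_distrib)
  have "ln ((a ^ n - b ^ n) / (a - b)) = of_nat n * ln a + ln (1 - (b / a) ^ n) - ln (a - b)"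
    unfolding eq using assms pos ab by (simp add: ln_div ln_mult_pos ln_realpow)
  moreover have "0 < (a ^ n - b ^ n) / (a - b)"
    unfolding eq using assms pos ab by simp
  ultimately have "1 / complex_of_real ((a ^ n - b ^ n) / (a - b)) powr s =
      exp (- (s * of_real (of_nat n * ln a + ln (1 - (b / a) ^ n) - ln (a - b))))"
    by (simp only: powr_of_real_eq_exp exp_minus inverse_eq_divide)
  also have "\<dots> = exp (s * of_real (ln (a - b))) * (exp (- of_real (ln a) * s * of_nat n) * exp (- s * of_real (ln (1 - (b / a) ^ n))))"
    by (simp add: algebra_simps flip: exp_add)
  also have "exp (- s * of_real (ln (1 - (b / a) ^ n))) = (1 - of_real (b / a) ^ n) powr (- s)"
    using powr_of_real_eq_exp[OF pos, of "- s"] by simp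
  finally show ?thesis .
qed

theorem theorem6:
  fixes P Q :: real and q :: nat
    and chi :: "'d::{finite,linorder} \<Rightarrow> int \<Rightarrow> complex"
  assumes "P > 0" and "Q \<noteq> 0"
    and "P \<le> 2 \<Longrightarrow> Q < P - 1"
    and "P > 2 \<Longrightarrow> Q \<le> P - 1"
    and "q \<ge> 2"
    and "\<And>i. dirichlet_character q (chi i)"
  shows "\<exists>F :: complex ^ 'd::{finite,linorder} \<Rightarrow> complex.
           meromorphic_several_on F UNIV \<and>
           holomorphic_several_on F
             (- (\<Union>(j::'d) (k::'d \<Rightarrow> nat) (n::int). lucas_hyperplane P Q q j k n)) \<and>
           (\<forall>s\<in>lucas_domain. F s = multiple_lucas_L P Q chi s)"
proof -
  define a b where "a = lucas_alpha P Q" and "b = lucas_beta P Q"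
  have a: "a > 1" and ba: "\<bar>b\<bar> < a" and ab: "a * b = Q"
    using lucas_roots[OF assms(1-4)] by (simp_all add: a_def b_def)
  define w :: "('d \<Rightarrow> nat) \<Rightarrow> complex" where "w = (\<lambda>m. \<Prod>i\<in>UNIV. chi i (int (position m i)))"
  have w_periodic: "w (\<lambda>j. r j + q * t j) = w r" for r t
  proof -
    have "chi i (int (position (\<lambda>j. r j + q * t j) i)) = chi i (int (position r i))" for i
    proof -
      have "position (\<lambda>j. r j + q * t j) i = position r i + q * (\<Sum>l\<in>{..i}. t l)"
        by (simp add: position_def sum_distrib_left flip: sum.distrib)
      then show ?thesis using dirichlet_character_periodic[OF assms(6)] by (simp only: of_nat_add)
    qed
    then show ?thesis by (simp add: w_def)
  qed
  interpret lucas_continuation "ln a" "b / a" q w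
    by unfold_locales (use a ba assms(5) w_periodic in auto)
  \<comment> \<open>The denominators \<alpha> - \<beta> of the Lucas numbers contribute this entire
    factor, independent of the summation indices.\<close>
  define C :: "complex ^ 'd::{finite,linorder} \<Rightarrow> complex"
    where "C = (\<lambda>s. \<Prod>i\<in>UNIV. exp (s $ i * of_real (ln (a - b))))"
  have C: "cdiff_at C s" for s
    unfolding C_def by (intro cdiff_at_prod cdiff_at_exp cdiff_at_mult cdiff_at_nth cdiff_at_const)
  have b0: "b / a \<noteq> 0" using ab assms(2) by auto
  have sign: "b / a < 0 \<longleftrightarrow> Q < 0"
    using a ab by (auto simp: divide_less_0_iff mult_less_0_iff)
  \<comment> \<open>Because \<open>b / a = Q / a\<^sup>2\<close>; this produces the term -2 in the
    hyperplane equation.\<close>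
  have "ln \<bar>b / a\<bar> = ln \<bar>Q\<bar> - 2 * ln a"
    using a b0 by (simp add: ab[symmetric] abs_mult ln_mult_pos ln_div)
  then have log: "ln \<bar>b / a\<bar> / ln a = ln \<bar>Q\<bar> / ln a - 2"
    using a by (simp add: field_simps)
  have hyper: "y s j (tail k j) ^ q = 1 \<longleftrightarrow> (\<exists>n. s \<in> lucas_hyperplane P Q q j k n)" for s j k
    unfolding y_power_eq_1_iff[OF b0] log lucas_hyperplane_def tail_def mem_Collect_eq lucas_ell_def sign
      a_def[symmetric]
    by (simp add: algebra_simps)
  \<comment> \<open>Every \<open>K\<close> is the tail sum of some \<open>k\<close>, so indexing the
    poles by \<open>K\<close> or by \<open>k\<close> gives the same set.\<close>
  have "tail (\<lambda>i. if i = j then K else 0) j = K" for j K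
    by (simp add: tail_def)
  then have poles: "{s. \<exists>j K. y s j K ^ q = 1} = (\<Union>j k n. lucas_hyperplane P Q q j k n)"
    unfolding set_eq_iff mem_Collect_eq UN_iff by (metis hyper UNIV_I)
  have "C s * F s = multiple_lucas_L P Q chi s" if "s \<in> lucas_domain" for s
  proof -
    have "multiple_lucas_L P Q chi s =
      (\<Sum>\<^sub>\<infinity>m. \<Prod>i\<in>UNIV. chi i (int (position m i)) / complex_of_real (lucas_U P Q (position m i)) powr (s $ i))"
      unfolding multiple_lucas_L_def by (rule infsum_reindex_bij_betw[OF bij_betw_position, symmetric])
    also have "\<dots> = (\<Sum>\<^sub>\<infinity>m. C s * (w m * (\<Prod>i\<in>UNIV. exp (- of_real (ln a) * s $ i * of_nat (position m i)) *
           (1 - of_real (b / a) ^ position m i) powr (- s $ i))))"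
    proof (rule infsum_cong)
      fix m :: "'d \<Rightarrow> nat"
      have "chi i (int (position m i)) / complex_of_real (lucas_U P Q (position m i)) powr (s $ i) =
        exp (s $ i * of_real (ln (a - b))) * (chi i (int (position m i)) * (exp (- of_real (ln a) * s $ i * of_nat (position m i)) *
           (1 - of_real (b / a) ^ position m i) powr (- s $ i)))" for i
      proof -
        have "position m i > 0" using position_previous[of m i] by simp
        from inverse_lucas_U_powr[OF a ba this, of "s $ i"] show ?thesis
          unfolding lucas_U_def a_def[symmetric] b_def[symmetric] divide_inverse[of "chi _ _"]
          by (simp only: inverse_eq_divide mult_ac)
      qed
      then show "(\<Prod>i\<in>UNIV. chi i (int (position m i)) / complex_of_real (lucas_U P Q (position m i)) powr (s $ i)) =
        C s * (w m * (\<Prod>i\<in>UNIV. exp (- of_real (ln a) * s $ i * of_nat (position m i)) *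
           (1 - of_real (b / a) ^ position m i) powr (- s $ i)))"
        by (simp only: C_def w_def prod.distrib)
    qed
    also have "\<dots> = C s * F s"
      unfolding infsum_cmult_right' using F_eq[of s] that by (simp add: lucas_domain_def)
    finally show ?thesis ..
  qed
  moreover have "meromorphic_several_on (\<lambda>s. C s * F s) UNIV"
    by (rule meromorphic_several_on_mult[OF _ meromorphic_several_on_F])
      (simp add: holomorphic_several_on_iff C)
  moreover have "holomorphic_several_on (\<lambda>s. C s * F s) (- (\<Union>j k n. lucas_hyperplane P Q q j k n))"
    using holomorphic_several_on_F C unfolding poles holomorphic_several_on_iff
    by (auto intro!: cdiff_at_mult)
  ultimately show ?thesis by blast
qed

end
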